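(* Let $K$ be a field equipped with an automorphism $\sigma$, and let $c$ be an element of $K$ such that $c^\sigma \neq c$ and $c^{\sigma^2}=c$. Let $D = K((t,\sigma))$ and let $M$ be the left ideal of $D[x,y]$ generated by $(x+t)(x-t)$ and $y-c$. Then $M$ is a maximal left ideal of $D[x,y]$ such that $D[x] \cap M$ is not a maximal left ideal of $D[x]$.
   Context: For a field $K$ with an automorphism $\sigma$, write $u^\sigma$ for the image of $u\in K$ under $\sigma$. $K((t,\sigma))$ denotes the skew Laurent power series ring over $K$: its elements are the formal Laurent series $\sum_{i=m}^\infty f_i t^i$ with $m\in\mathbb{Z}$ and $f_i\in K$, with the usual addition, and multiplication determined by the rule $tu = u^\sigma t$ for all $u \in K$. It is a division ring (a known fact). For a division ring $D$, $D[x]$ and $D[x,y]$ denote the rings of polynomials over $D$ in one, respectively two, central variables (the variables commute with each other and with all elements of $D$); $D[x]$ is regarded as a subring of $D[x,y]$. *)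

theory Defs
  imports "HOL-Algebra.UnivPoly" "HOL-Algebra.QuotRing"
begin

subsection \<open>Left ideals\<close>

text \<open>One-sided analogues of \<^locale>\<open>ideal\<close>, \<^const>\<open>genideal\<close> and \<^locale>\<open>maximalideal\<close>.\<close>

locale left_ideal = additive_subgroup I R + ring R for I and R (structure) +
  assumes l_closed: "\<lbrakk>a \<in> I; x \<in> carrier R\<rbrakk> \<Longrightarrow> x \<otimes> a \<in> I"

definition gen_left_ideal :: "('a, 'm) ring_scheme \<Rightarrow> 'a set \<Rightarrow> 'a set"
  where "gen_left_ideal R S = \<Inter>{I. left_ideal I R \<and> S \<subseteq> I}"

locale maximal_left_ideal = left_ideal +
  assumes I_notcarr: "carrier R \<noteq> I"
    and I_maximal: "\<lbrakk>left_ideal J R; I \<subseteq> J; J \<subseteq> carrier R\<rbrakk> \<Longrightarrow> J = I \<or> J = carrier R"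


subsection \<open>Skew Laurent series\<close>

definition aut_pow :: "('a, 'm) ring_scheme \<Rightarrow> ('a \<Rightarrow> 'a) \<Rightarrow> int \<Rightarrow> 'a \<Rightarrow> 'a"
  where "aut_pow K \<sigma> i =
    (if 0 \<le> i then \<sigma> ^^ nat i else inv_into (carrier K) \<sigma> ^^ nat (- i))"

text \<open>
  A function \<open>f\<close> stands for the series with coefficient \<open>f i\<close> to the left of \<open>t\<close> to the power
  \<open>i\<close>.  The rule \<open>t u = u\<^sup>\<sigma> t\<close> turns the product of \<open>a t^i\<close> and \<open>b t^j\<close> into
  \<open>(a \<sigma>^i(b)) t^(i + j)\<close>, for negative \<open>i\<close> as well.  In the product the sum is restricted to
  the terms with nonzero factors because \<^const>\<open>finsum\<close> is only meaningful over finite sets.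
\<close>

definition skew_laurent :: "('a, 'm) ring_scheme \<Rightarrow> ('a \<Rightarrow> 'a) \<Rightarrow> (int \<Rightarrow> 'a) ring"
  where "skew_laurent K \<sigma> = \<lparr>
    carrier = {f \<in> UNIV \<rightarrow> carrier K. \<exists>m. \<forall>i<m. f i = \<zero>\<^bsub>K\<^esub>},
    mult = (\<lambda>f g n. \<Oplus>\<^bsub>K\<^esub>i\<in>{i. f i \<noteq> \<zero>\<^bsub>K\<^esub> \<and> g (n - i) \<noteq> \<zero>\<^bsub>K\<^esub>}.
                      f i \<otimes>\<^bsub>K\<^esub> aut_pow K \<sigma> i (g (n - i))),
    one = (\<lambda>n. if n = 0 then \<one>\<^bsub>K\<^esub> else \<zero>\<^bsub>K\<^esub>),
    zero = (\<lambda>n. \<zero>\<^bsub>K\<^esub>),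
    add = (\<lambda>f g n. f n \<oplus>\<^bsub>K\<^esub> g n)\<rparr>"

definition sl_monom :: "('a, 'm) ring_scheme \<Rightarrow> 'a \<Rightarrow> int \<Rightarrow> int \<Rightarrow> 'a"
  where "sl_monom K a k = (\<lambda>n. if n = k then a else \<zero>\<^bsub>K\<^esub>)"


subsection \<open>Polynomials in two central variables\<close>

text \<open>
  \<^term>\<open>UP R\<close> makes sense for noncommutative \<open>R\<close>, and its variable is central.  The ring
  \<open>R[x,y]\<close> is realised as \<open>R[x][y]\<close>; its subring \<open>R[x]\<close> consists of the polynomials \<open>const_y R p\<close>.
\<close>

abbreviation UP2 :: "('a, 'm) ring_scheme \<Rightarrow> (nat \<Rightarrow> 'a, nat \<Rightarrow> nat \<Rightarrow> 'a) up_ring"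
  where "UP2 R \<equiv> UP (UP R)"

definition const_y :: "('a, 'm) ring_scheme \<Rightarrow> (nat \<Rightarrow> 'a) \<Rightarrow> nat \<Rightarrow> nat \<Rightarrow> 'a"
  where "const_y R p = monom (UP2 R) p 0"

definition const_xy :: "('a, 'm) ring_scheme \<Rightarrow> 'a \<Rightarrow> nat \<Rightarrow> nat \<Rightarrow> 'a"
  where "const_xy R a = const_y R (monom (UP R) a 0)"

definition var_x :: "('a, 'm) ring_scheme \<Rightarrow> nat \<Rightarrow> nat \<Rightarrow> 'a"
  where "var_x R = const_y R (monom (UP R) \<one>\<^bsub>R\<^esub> 1)"

definition var_y :: "('a, 'm) ring_scheme \<Rightarrow> nat \<Rightarrow> nat \<Rightarrow> 'a"
  where "var_y R = monom (UP2 R) \<one>\<^bsub>UP R\<^esub> 1"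

text \<open>The intersection of \<open>R[x]\<close> with a subset of \<open>R[x,y]\<close>, as a subset of \<^term>\<open>UP R\<close>.\<close>

definition inter_x :: "('a, 'm) ring_scheme \<Rightarrow> (nat \<Rightarrow> nat \<Rightarrow> 'a) set \<Rightarrow> (nat \<Rightarrow> 'a) set"
  where "inter_x R M = {p \<in> carrier (UP R). const_y R p \<in> M}"


subsection \<open>The left ideal of interest\<close>

definition sl_left_ideal ::
    "('a, 'm) ring_scheme \<Rightarrow> ('a \<Rightarrow> 'a) \<Rightarrow> 'a \<Rightarrow> (nat \<Rightarrow> nat \<Rightarrow> int \<Rightarrow> 'a) set"
  where "sl_left_ideal K \<sigma> c =
    (let D = skew_laurent K \<sigma>; P = UP2 D;
         x = var_x D; y = var_y D;
         t = const_xy D (sl_monom K \<one>\<^bsub>K\<^esub> 1);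
         c' = const_xy D (sl_monom K c 0)
     in gen_left_ideal P {(x \<oplus>\<^bsub>P\<^esub> t) \<otimes>\<^bsub>P\<^esub> (x \<ominus>\<^bsub>P\<^esub> t), y \<ominus>\<^bsub>P\<^esub> c'})"

end

theory Submission
  imports Defs
begin

text \<open>
  Write \<open>G = (x + t)(x - t) = x\<^sup>2 - t\<^sup>2\<close>. Modulo the left ideal generated by \<open>y - c\<close>, a polynomial
  in \<open>y\<close> with coefficients in \<open>D[x]\<close> on the left is determined by its value at \<open>y = c\<close>. Thus
  \<open>D[x,y] / D[x,y](y - c)\<close> is \<open>D[x]\<close>, on which \<open>y\<close> acts by right multiplication by \<open>c\<close>. Since
  \<open>\<sigma>\<^sup>2(c) = c\<close>, the element \<open>c\<close> commutes with \<open>t\<^sup>2\<close> and hence with \<open>G\<close>, so \<open>D[x] G\<close> is stable under this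
  action. It follows that \<open>D[x,y] / M\<close> is \<open>D[x] / D[x] G\<close> and that \<open>D[x] \<inter> M = D[x] G\<close>
  (\<open>M_reval\<close>, \<open>inter_x_M_principal\<close>). The latter is properly contained in the proper left ideal
  \<open>D[x](x - t)\<close>, which proves the negative part of the theorem.

  For the maximality of \<open>M\<close> it remains to see that \<open>D[x] / D[x] G\<close>, a left vector space over \<open>D\<close> with basis
  \<open>1, x\<close>, has no proper nonzero subspace stable under \<open>x\<close> and under right multiplication by \<open>c\<close>
  (\<open>stable_left_ideal_trivial\<close>). Such a subspace would be spanned by some \<open>x + e\<close>; stability
  under \<open>c\<close> means \<open>e c = c e\<close> and stability under \<open>x\<close> means \<open>e\<^sup>2 = t\<^sup>2\<close>. In the skew Laurent
  series ring no \<open>e\<close> has both properties (\<open>commuting_square_neq\<close>): the second makes \<open>e\<close> start in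
  degree 1, where commuting with \<open>c\<close> would mean \<open>\<sigma>(c) = c\<close>.

  The passage to one-dimensional subspaces uses that \<open>D\<close> is a division ring, so the ring axioms
  and the existence of inverses are established for skew Laurent series as well.
\<close>

section \<open>Left ideals\<close>

text \<open>
  Closure under negation comes for free: it is multiplication by \<open>- 1\<close> from the left.
\<close>

lemma left_idealI:
  fixes R (structure)
  assumes "ring R" and "I \<subseteq> carrier R" and "\<zero> \<in> I"
    and "\<And>a b. \<lbrakk>a \<in> I; b \<in> I\<rbrakk> \<Longrightarrow> a \<oplus> b \<in> I"
    and l_closed: "\<And>a x. \<lbrakk>a \<in> I; x \<in> carrier R\<rbrakk> \<Longrightarrow> x \<otimes> a \<in> I"
  shows "left_ideal I R"
proof -
  interpret ring R by fact
  have "\<ominus> a \<in> I" if "a \<in> I" for a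
  proof -
    have "(\<ominus> \<one>) \<otimes> a \<in> I" using l_closed that by simp
    moreover have "(\<ominus> \<one>) \<otimes> a = \<ominus> a" using that assms(2) l_minus[of \<one> a] by auto
    ultimately show ?thesis by simp
  qed
  then have "additive_subgroup I R"
    unfolding additive_subgroup_def using assms(2-4)
    by (intro add.subgroupI) (auto simp: a_inv_def)
  then show ?thesis
    unfolding left_ideal_def left_ideal_axioms_def using l_closed ring_axioms by blast
qed

context left_ideal
begin

lemma minus_closed: "\<lbrakk>a \<in> I; b \<in> I\<rbrakk> \<Longrightarrow> a \<ominus> b \<in> I"
  unfolding a_minus_def by (simp add: a_closed a_inv_closed)

lemma eq_carrierI: "\<one> \<in> I \<Longrightarrow> I = carrier R"
  using l_closed[of \<one>] a_subset by fastforce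

end

context ring
begin

lemma carrier_left_ideal: "left_ideal (carrier R) R"
  by (rule left_idealI) (auto intro: ring_axioms)

lemma gen_left_ideal_left_ideal:
  assumes "S \<subseteq> carrier R"
  shows "left_ideal (gen_left_ideal R S) R"
proof (rule left_idealI)
  show "gen_left_ideal R S \<subseteq> carrier R"
    unfolding gen_left_ideal_def using carrier_left_ideal assms by blast
qed (auto simp: gen_left_ideal_def ring_axioms left_ideal.l_closed
    dest: left_ideal.axioms(1) intro: additive_subgroup.zero_closed additive_subgroup.a_closed)

lemma gen_left_ideal_subset: "S \<subseteq> gen_left_ideal R S"
  unfolding gen_left_ideal_def by blast

lemma gen_left_ideal_minimal: "\<lbrakk>left_ideal I R; S \<subseteq> I\<rbrakk> \<Longrightarrow> gen_left_ideal R S \<subseteq> I"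
  unfolding gen_left_ideal_def by blast

definition principal_left_ideal :: "'a \<Rightarrow> 'a set"
  where "principal_left_ideal g = (\<lambda>q. q \<otimes> g) ` carrier R"

lemma principal_left_ideal_left_ideal:
  assumes "g \<in> carrier R"
  shows "left_ideal (principal_left_ideal g) R"
proof (rule left_idealI)
  show "\<zero> \<in> principal_left_ideal g"
    unfolding principal_left_ideal_def using assms by (intro image_eqI[of _ _ \<zero>]) auto
  show "a \<oplus> b \<in> principal_left_ideal g"
    if "a \<in> principal_left_ideal g" "b \<in> principal_left_ideal g" for a b
    using that assms unfolding principal_left_ideal_def by (auto simp: l_distr[symmetric])
  show "x \<otimes> a \<in> principal_left_ideal g"
    if "a \<in> principal_left_ideal g" "x \<in> carrier R" for a x
    using that assms unfolding principal_left_ideal_def by (auto simp: m_assoc[symmetric])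
qed (use assms ring_axioms in \<open>auto simp: principal_left_ideal_def\<close>)

lemma principal_left_ideal_self: "g \<in> carrier R \<Longrightarrow> g \<in> principal_left_ideal g"
  unfolding principal_left_ideal_def by (intro image_eqI[of _ _ \<one>]) auto

end

section \<open>Polynomials over a noncommutative ring\<close>

context UP_ring
begin

lemma UP_induct_monom [consumes 1, case_names monom add]:
  assumes "p \<in> carrier P"
    and monom: "\<And>a n. a \<in> carrier R \<Longrightarrow> Q (monom P a n)"
    and add: "\<And>p q. \<lbrakk>p \<in> carrier P; q \<in> carrier P; Q p; Q q\<rbrakk> \<Longrightarrow> Q (p \<oplus>\<^bsub>P\<^esub> q)"
  shows "Q p"
proof -
  have "Q (\<Oplus>\<^bsub>P\<^esub> i \<in> A. monom P (coeff P p i) i)" if "finite A" for A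
    using that
  proof (induction A rule: finite_induct)
    case empty
    show ?case using monom[of \<zero> 0] by simp
  next
    case (insert i A)
    then show ?case
      using assms(1) by (auto intro!: add monom P.finsum_closed)
  qed
  from this[of "{..deg R p}"] show ?thesis
    using up_repr[OF assms(1)] by simp
qed

text \<open>
  Multiplication by the variable together with constants and sums generates all polynomials.
  This replaces computations with coefficients wherever a property is compatible with
  multiplication by the variable.
\<close>

lemma UP_induct_X [consumes 1, case_names const X_mult add]:
  assumes "p \<in> carrier P"
    and const: "\<And>a. a \<in> carrier R \<Longrightarrow> Q (monom P a 0)"
    and X_mult: "\<And>p. \<lbrakk>p \<in> carrier P; Q p\<rbrakk> \<Longrightarrow> Q (monom P \<one> 1 \<otimes>\<^bsub>P\<^esub> p)"
    and add: "\<And>p q. \<lbrakk>p \<in> carrier P; q \<in> carrier P; Q p; Q q\<rbrakk> \<Longrightarrow> Q (p \<oplus>\<^bsub>P\<^esub> q)"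
  shows "Q p"
  using assms(1)
proof (induction rule: UP_induct_monom)
  case (monom a n)
  show ?case
  proof (induction n)
    case (Suc n)
    have "monom P a (Suc n) = monom P \<one> 1 \<otimes>\<^bsub>P\<^esub> monom P a n"
      using monom_mult[of \<one> a 1 n] monom by simp
    then show ?case using X_mult[of "monom P a n"] Suc monom by simp
  qed (simp add: const monom)
qed (rule add)

lemma X_central:
  assumes "p \<in> carrier P"
  shows "p \<otimes>\<^bsub>P\<^esub> monom P \<one> 1 = monom P \<one> 1 \<otimes>\<^bsub>P\<^esub> p"
  using assms
proof (induction rule: UP_induct_monom)
  case (monom a n)
  then show ?case
    using monom_mult[of a \<one> n 1] monom_mult[of \<one> a 1 n] by simp
qed (simp add: P.l_distr P.r_distr)

lemma coeff_mult_leading: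
  assumes p: "p \<in> carrier P" and q: "q \<in> carrier P"
  shows "coeff P (p \<otimes>\<^bsub>P\<^esub> q) (deg R p + deg R q) = coeff P p (deg R p) \<otimes> coeff P q (deg R q)"
proof -
  let ?f = "\<lambda>i. coeff P p i \<otimes> coeff P q (deg R p + deg R q - i)"
  have "?f i = (if deg R p = i then ?f i else \<zero>)" for i
    using p q deg_aboveD[of p i] deg_aboveD[of q "deg R p + deg R q - i"]
    by (cases i "deg R p" rule: linorder_cases) auto
  then have "(\<Oplus>i\<in>{..deg R p + deg R q}. ?f i) =
      (\<Oplus>i\<in>{..deg R p + deg R q}. if deg R p = i then ?f i else \<zero>)"
    by presburger
  also have "\<dots> = ?f (deg R p)"
    using p q by (intro R.finsum_singleton) auto
  finally show ?thesis using p q by simp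
qed

text \<open>
  A leading coefficient 1 cannot be annihilated, so \<open>q g\<close> has degree \<open>deg q + deg g\<close> for every
  nonzero \<open>q\<close>, even if \<open>R\<close> has zero divisors. This is how elements are shown to lie
  outside a principal left ideal.
\<close>

lemma principal_monic_deg_le:
  assumes g: "g \<in> carrier P" and monic: "coeff P g (deg R g) = \<one>"
    and p: "p \<in> P.principal_left_ideal g" and "p \<noteq> \<zero>\<^bsub>P\<^esub>"
  shows "deg R g \<le> deg R p"
proof -
  obtain q where q: "q \<in> carrier P" and p_eq: "p = q \<otimes>\<^bsub>P\<^esub> g"
    using p unfolding P.principal_left_ideal_def by blast
  with \<open>p \<noteq> \<zero>\<^bsub>P\<^esub>\<close> g have "q \<noteq> \<zero>\<^bsub>P\<^esub>" by auto
  then have "coeff P p (deg R q + deg R g) \<noteq> \<zero>"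
    using coeff_mult_leading[OF q g] lcoeff_nonzero[OF _ q] monic q p_eq by simp
  then have "deg R q + deg R g \<le> deg R p"
    using deg_belowI[of "deg R q + deg R g" p] q g p_eq by auto
  then show ?thesis by simp
qed

text \<open>
  Evaluation at \<open>s\<close> with the powers of \<open>s\<close> to the right of the coefficients. As \<open>R\<close> need not be
  commutative, this is not multiplicative, but it is a homomorphism of left \<open>R\<close>-modules that turns
  multiplication by the variable into right multiplication by \<open>s\<close>.
\<close>

definition reval :: "'a \<Rightarrow> (nat \<Rightarrow> 'a) \<Rightarrow> 'a"
  where "reval s p = (\<Oplus>i\<in>{..deg R p}. coeff P p i \<otimes> s [^] i)"

context
  fixes s
  assumes s: "s \<in> carrier R"
begin

lemma reval_closed [simp]: "p \<in> carrier P \<Longrightarrow> reval s p \<in> carrier R"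
  unfolding reval_def using s by (intro R.finsum_closed) auto

lemma reval_bound:
  assumes "p \<in> carrier P" and "deg R p \<le> n"
  shows "reval s p = (\<Oplus>i\<in>{..n}. coeff P p i \<otimes> s [^] i)"
  unfolding reval_def using s assms
  by (intro R.add.finprod_mono_neutral_cong_left) (auto simp: deg_aboveD)

lemma reval_add:
  assumes "p \<in> carrier P" and "q \<in> carrier P"
  shows "reval s (p \<oplus>\<^bsub>P\<^esub> q) = reval s p \<oplus> reval s q"
proof -
  let ?n = "max (deg R p) (deg R q)"
  have "reval s (p \<oplus>\<^bsub>P\<^esub> q) =
      (\<Oplus>i\<in>{..?n}. coeff P p i \<otimes> s [^] i \<oplus> coeff P q i \<otimes> s [^] i)"
    using assms s reval_bound[of "p \<oplus>\<^bsub>P\<^esub> q" ?n] deg_add[of p q]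
    by (simp add: R.l_distr)
  also have "\<dots> = reval s p \<oplus> reval s q"
    using assms s reval_bound[of p ?n] reval_bound[of q ?n]
    by (simp add: R.finsum_addf Pi_def)
  finally show ?thesis .
qed

lemma reval_monom:
  assumes "a \<in> carrier R"
  shows "reval s (monom P a n) = a \<otimes> s [^] n"
proof -
  have "reval s (monom P a n) = (\<Oplus>i\<in>{..n}. coeff P (monom P a n) i \<otimes> s [^] i)"
    using assms deg_monom_le by (intro reval_bound) auto
  also have "\<dots> = (\<Oplus>i\<in>{..n}. if n = i then a \<otimes> s [^] i else \<zero>)"
    using assms s by (intro R.finsum_cong') auto
  also have "\<dots> = a \<otimes> s [^] n"
    using assms s by (intro R.finsum_singleton) auto
  finally show ?thesis .
qed

lemma reval_const_mult:
  assumes "p \<in> carrier P" and a: "a \<in> carrier R"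
  shows "reval s (monom P a 0 \<otimes>\<^bsub>P\<^esub> p) = a \<otimes> reval s p"
  using assms(1)
proof (induction rule: UP_induct_monom)
  case (monom b n)
  then show ?case
    using monom_mult[of a b 0 n, symmetric] a s by (simp add: reval_monom R.m_assoc del: monom_mult)
qed (use a in \<open>simp add: P.r_distr reval_add R.r_distr\<close>)

lemma reval_X_mult:
  assumes "p \<in> carrier P"
  shows "reval s (monom P \<one> 1 \<otimes>\<^bsub>P\<^esub> p) = reval s p \<otimes> s"
  using assms
proof (induction rule: UP_induct_monom)
  case (monom b n)
  then show ?case
    using monom_mult[of \<one> b 1 n, symmetric] s by (simp add: reval_monom R.m_assoc del: monom_mult)
qed (use s in \<open>simp add: P.r_distr reval_add R.l_distr\<close>)

text \<open>
  Right evaluation identifies \<open>R[X] / R[X](X - s)\<close> with \<open>R\<close>, on which the variable acts by right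
  multiplication by \<open>s\<close>. Hence the left ideals of \<open>R[X]\<close> above \<open>X - s\<close> correspond to the left ideals
  of \<open>R\<close> that are stable under this action.
\<close>

lemma reval_vimage_left_ideal:
  assumes N: "left_ideal N R" and stable: "\<And>a. a \<in> N \<Longrightarrow> a \<otimes> s \<in> N"
  shows "left_ideal {p \<in> carrier P. reval s p \<in> N} P"
proof (rule left_idealI)
  interpret N: left_ideal N R by fact
  show "\<zero>\<^bsub>P\<^esub> \<in> {p \<in> carrier P. reval s p \<in> N}"
    using reval_monom[of \<zero> 0] by (simp add: s)
  show "p \<oplus>\<^bsub>P\<^esub> q \<in> {p \<in> carrier P. reval s p \<in> N}"
    if "p \<in> {p \<in> carrier P. reval s p \<in> N}" "q \<in> {p \<in> carrier P. reval s p \<in> N}" for p q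
    using that by (simp add: reval_add)
  show "f \<otimes>\<^bsub>P\<^esub> p \<in> {p \<in> carrier P. reval s p \<in> N}"
    if p: "p \<in> {p \<in> carrier P. reval s p \<in> N}" and f: "f \<in> carrier P" for p f
  proof -
    have "reval s (f \<otimes>\<^bsub>P\<^esub> p) \<in> N"
      using f
    proof (induction rule: UP_induct_X)
      case (const a)
      then show ?case using p by (simp add: reval_const_mult N.l_closed)
    next
      case (X_mult q)
      then show ?case using p stable by (simp add: P.m_assoc reval_X_mult del: One_nat_def)
    next
      case (add q r)
      then show ?case using p by (simp add: P.l_distr reval_add)
    qed
    then show ?thesis using p f by simp
  qed
qed (auto intro: P.ring_axioms)

end

end

section \<open>Identities involving commuting elements\<close>

context ring
begin

lemma minus_zero_imp_eq:
  assumes "a \<in> carrier R" "b \<in> carrier R" "a \<ominus> b = \<zero>"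
  shows "a = b"
proof -
  have "a = (a \<ominus> b) \<oplus> b" using assms(1,2) by algebra
  then show ?thesis using assms by simp
qed

lemma add_minus_cancel_left: "\<lbrakk>a \<in> carrier R; b \<in> carrier R\<rbrakk> \<Longrightarrow> (a \<oplus> b) \<ominus> a = b"
  by algebra

lemma minus_minus_cancel: "\<lbrakk>a \<in> carrier R; b \<in> carrier R\<rbrakk> \<Longrightarrow> a \<ominus> (a \<ominus> b) = b"
  by algebra

lemma minus_cancel_left: "\<lbrakk>a \<in> carrier R; b \<in> carrier R; d \<in> carrier R\<rbrakk> \<Longrightarrow>
    (d \<ominus> a) \<ominus> (d \<ominus> b) = b \<ominus> a"
  by algebra

lemma add_diff_interchange:
    "\<lbrakk>a \<in> carrier R; b \<in> carrier R; d \<in> carrier R; e \<in> carrier R\<rbrakk> \<Longrightarrow>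
    (a \<ominus> b) \<oplus> (d \<ominus> e) = (a \<oplus> d) \<ominus> (b \<oplus> e)"
  by algebra

lemma square_diff:
  assumes "x \<in> carrier R" "a \<in> carrier R" "a \<otimes> x = x \<otimes> a"
  shows "(x \<oplus> a) \<otimes> (x \<ominus> a) = x \<otimes> x \<ominus> a \<otimes> a"
    and "(x \<ominus> a) \<otimes> (x \<oplus> a) = x \<otimes> x \<ominus> a \<otimes> a"
  using assms by algebra+

lemma commutator_add_central:
  assumes "x \<in> carrier R" "a \<in> carrier R" "b \<in> carrier R" "b \<otimes> x = x \<otimes> b"
  shows "(x \<oplus> a) \<otimes> b \<ominus> b \<otimes> (x \<oplus> a) = a \<otimes> b \<ominus> b \<otimes> a"
  using assms by algebra

lemma central_mult_minus:
  assumes "y \<in> carrier R" "p \<in> carrier R" "d \<in> carrier R" "p \<otimes> y = y \<otimes> p"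
  shows "y \<otimes> p \<ominus> p \<otimes> (y \<ominus> d) = p \<otimes> d"
  using assms by algebra

lemma central_mult_add:
  assumes "y \<in> carrier R" "p \<in> carrier R" "d \<in> carrier R" "p \<otimes> y = y \<otimes> p" "f \<in> carrier R"
  shows "y \<otimes> (f \<ominus> p) \<oplus> p \<otimes> (y \<ominus> d) = y \<otimes> f \<ominus> p \<otimes> d"
  using assms by algebra

end

section \<open>The left ideal over an abstract division ring\<close>

text \<open>
  All that the argument needs from the skew Laurent series ring: a division ring with elements
  \<open>t\<close> and \<open>c\<close> such that \<open>c\<close> commutes with \<open>t\<^sup>2\<close>, but no square root of \<open>t\<^sup>2\<close> commutes with \<open>c\<close>.
  In particular \<open>t\<close> itself does not commute with \<open>c\<close>.
\<close>

locale no_commuting_root = ring D for D (structure) +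
  fixes t c
  assumes one_neq_zero: "\<one> \<noteq> \<zero>"
    and left_inverse: "\<lbrakk>a \<in> carrier D; a \<noteq> \<zero>\<rbrakk> \<Longrightarrow> \<exists>b\<in>carrier D. b \<otimes> a = \<one>"
    and t_closed [simp]: "t \<in> carrier D"
    and c_closed [simp]: "c \<in> carrier D"
    and c_commutes: "c \<otimes> (t \<otimes> t) = t \<otimes> t \<otimes> c"
    and no_root: "\<lbrakk>d \<in> carrier D; d \<otimes> c = c \<otimes> d\<rbrakk> \<Longrightarrow> d \<otimes> d \<noteq> t \<otimes> t"
begin

abbreviation Dx where "Dx \<equiv> UP D"
abbreviation Dxy where "Dxy \<equiv> UP (UP D)"

sublocale x: UP_ring D "UP D"
  by unfold_locales simp
sublocale xy: UP_ring "UP D" "UP (UP D)"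
  by unfold_locales simp

definition X where "X = monom Dx \<one> 1"
definition cx :: "'a \<Rightarrow> nat \<Rightarrow> 'a" where "cx a = monom Dx a 0"
definition G where "G = X \<otimes>\<^bsub>Dx\<^esub> X \<ominus>\<^bsub>Dx\<^esub> cx (t \<otimes> t)"

lemma X_closed [simp]: "X \<in> carrier Dx"
  unfolding X_def by simp

lemma cx_closed [simp]: "a \<in> carrier D \<Longrightarrow> cx a \<in> carrier Dx"
  unfolding cx_def by simp

lemma G_closed [simp]: "G \<in> carrier Dx"
  unfolding G_def by simp

lemma cx_mult: "\<lbrakk>a \<in> carrier D; b \<in> carrier D\<rbrakk> \<Longrightarrow> cx (a \<otimes> b) = cx a \<otimes>\<^bsub>Dx\<^esub> cx b"
  unfolding cx_def using x.monom_mult[of a b 0 0] by simp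

lemma cx_add: "\<lbrakk>a \<in> carrier D; b \<in> carrier D\<rbrakk> \<Longrightarrow> cx (a \<oplus> b) = cx a \<oplus>\<^bsub>Dx\<^esub> cx b"
  unfolding cx_def by simp

lemma cx_minus: "\<lbrakk>a \<in> carrier D; b \<in> carrier D\<rbrakk> \<Longrightarrow> cx (a \<ominus> b) = cx a \<ominus>\<^bsub>Dx\<^esub> cx b"
  unfolding cx_def a_minus_def by simp

lemma cx_zero [simp]: "cx \<zero> = \<zero>\<^bsub>Dx\<^esub>"
  unfolding cx_def by simp

lemma cx_one [simp]: "cx \<one> = \<one>\<^bsub>Dx\<^esub>"
  unfolding cx_def by simp

lemma X_commute: "p \<in> carrier Dx \<Longrightarrow> p \<otimes>\<^bsub>Dx\<^esub> X = X \<otimes>\<^bsub>Dx\<^esub> p"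
  unfolding X_def by (rule x.X_central)

lemma X_cx_commute: "a \<in> carrier D \<Longrightarrow> cx a \<otimes>\<^bsub>Dx\<^esub> X = X \<otimes>\<^bsub>Dx\<^esub> cx a"
  by (simp add: X_commute)

lemma G_factor: "a \<in> carrier D \<Longrightarrow>
    (X \<oplus>\<^bsub>Dx\<^esub> cx a) \<otimes>\<^bsub>Dx\<^esub> (X \<ominus>\<^bsub>Dx\<^esub> cx a) = X \<otimes>\<^bsub>Dx\<^esub> X \<ominus>\<^bsub>Dx\<^esub> cx (a \<otimes> a)"
  by (simp add: x.P.square_diff X_cx_commute cx_mult)

text \<open>
  This is what makes \<open>D[x] G\<close> stable under right multiplication by \<open>c\<close>, that is, under the action
  of \<open>y\<close>; the left ideal generated by \<open>x - t\<close> does not have this property.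
\<close>

lemma G_c_commute: "G \<otimes>\<^bsub>Dx\<^esub> cx c = cx c \<otimes>\<^bsub>Dx\<^esub> G"
proof -
  have "X \<otimes>\<^bsub>Dx\<^esub> X \<otimes>\<^bsub>Dx\<^esub> cx c = cx c \<otimes>\<^bsub>Dx\<^esub> (X \<otimes>\<^bsub>Dx\<^esub> X)"
    by (metis X_cx_commute X_closed cx_closed c_closed x.P.m_assoc)
  moreover have "cx (t \<otimes> t) \<otimes>\<^bsub>Dx\<^esub> cx c = cx c \<otimes>\<^bsub>Dx\<^esub> cx (t \<otimes> t)"
    by (simp add: c_commutes flip: cx_mult)
  ultimately show ?thesis
    unfolding G_def by (simp add: x.P.l_distr x.P.r_distr x.P.minus_eq x.P.r_minus x.P.l_minus)
qed

lemma coeff_G: "coeff Dx G n = (if n = 2 then \<one> else if n = 0 then \<ominus> (t \<otimes> t) else \<zero>)"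
proof -
  have "X \<otimes>\<^bsub>Dx\<^esub> X = monom Dx \<one> 2"
    unfolding X_def using x.monom_mult[of \<one> \<one> 1 1] by (simp add: numeral_2_eq_2)
  then show ?thesis
    unfolding G_def cx_def by (simp add: minus_eq)
qed

lemma deg_G: "deg D G = 2"
proof (rule antisym)
  show "deg D G \<le> 2"
    by (rule x.deg_aboveI) (auto simp: coeff_G)
  show "2 \<le> deg D G"
    by (rule x.deg_belowI) (auto simp: coeff_G one_neq_zero)
qed

lemma coeff_X_minus_t:
  "coeff Dx (X \<ominus>\<^bsub>Dx\<^esub> cx t) n = (if n = 1 then \<one> else if n = 0 then \<ominus> t else \<zero>)"
  unfolding X_def cx_def by (simp add: minus_eq)

lemma deg_X_minus_t: "deg D (X \<ominus>\<^bsub>Dx\<^esub> cx t) = 1"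
proof (rule antisym)
  show "deg D (X \<ominus>\<^bsub>Dx\<^esub> cx t) \<le> 1"
    by (rule x.deg_aboveI) (auto simp: coeff_X_minus_t)
  show "1 \<le> deg D (X \<ominus>\<^bsub>Dx\<^esub> cx t)"
    by (rule x.deg_belowI) (auto simp: coeff_X_minus_t one_neq_zero)
qed

lemma one_neq_zero_Dx: "\<one>\<^bsub>Dx\<^esub> \<noteq> \<zero>\<^bsub>Dx\<^esub>"
  using one_neq_zero x.coeff_one[of 0] x.coeff_zero[of 0] by metis

text \<open>
  Division with remainder by \<open>G\<close>: the polynomials that have such a representation contain the constants and are closed under sums and, since
  \<open>x\<^sup>2 = G + t\<^sup>2\<close>, under multiplication by \<open>x\<close>.
\<close>

lemma G_remainder:
  assumes "p \<in> carrier Dx"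
  shows "\<exists>q a b. q \<in> carrier Dx \<and> a \<in> carrier D \<and> b \<in> carrier D \<and>
           p = q \<otimes>\<^bsub>Dx\<^esub> G \<oplus>\<^bsub>Dx\<^esub> (cx a \<oplus>\<^bsub>Dx\<^esub> cx b \<otimes>\<^bsub>Dx\<^esub> X)"
  using assms
proof (induction rule: x.UP_induct_X)
  case (const a)
  then show ?case
    by (intro exI[of _ "\<zero>\<^bsub>Dx\<^esub>"] exI[of _ a] exI[of _ \<zero>]) (simp add: cx_def)
next
  case (X_mult p)
  then obtain q a b where qab: "q \<in> carrier Dx" "a \<in> carrier D" "b \<in> carrier D"
    and p: "p = q \<otimes>\<^bsub>Dx\<^esub> G \<oplus>\<^bsub>Dx\<^esub> (cx a \<oplus>\<^bsub>Dx\<^esub> cx b \<otimes>\<^bsub>Dx\<^esub> X)"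
    by blast
  have XX: "X \<otimes>\<^bsub>Dx\<^esub> X = G \<oplus>\<^bsub>Dx\<^esub> cx (t \<otimes> t)"
    unfolding G_def by (simp add: x.P.minus_eq x.P.a_assoc x.P.l_neg)
  have "X \<otimes>\<^bsub>Dx\<^esub> (cx b \<otimes>\<^bsub>Dx\<^esub> X) = cx b \<otimes>\<^bsub>Dx\<^esub> (X \<otimes>\<^bsub>Dx\<^esub> X)"
    using qab X_commute[of "cx b \<otimes>\<^bsub>Dx\<^esub> X"] by (simp add: x.P.m_assoc)
  also have "\<dots> = cx b \<otimes>\<^bsub>Dx\<^esub> G \<oplus>\<^bsub>Dx\<^esub> cx (b \<otimes> (t \<otimes> t))"
    unfolding XX using qab by (simp add: x.P.r_distr cx_mult)
  finally have "X \<otimes>\<^bsub>Dx\<^esub> p = (X \<otimes>\<^bsub>Dx\<^esub> q \<oplus>\<^bsub>Dx\<^esub> cx b) \<otimes>\<^bsub>Dx\<^esub> G \<oplus>\<^bsub>Dx\<^esub>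
      (cx (b \<otimes> (t \<otimes> t)) \<oplus>\<^bsub>Dx\<^esub> cx a \<otimes>\<^bsub>Dx\<^esub> X)"
    unfolding p using qab
    by (simp add: x.P.r_distr x.P.l_distr x.P.m_assoc x.P.a_ac X_cx_commute[of a])
  then show ?case
    unfolding X_def[symmetric] using qab
    by (intro exI[of _ "X \<otimes>\<^bsub>Dx\<^esub> q \<oplus>\<^bsub>Dx\<^esub> cx b"] exI[of _ "b \<otimes> (t \<otimes> t)"] exI[of _ a]) simp
next
  case (add p p')
  then obtain q a b q' a' b' where
    qab: "q \<in> carrier Dx" "a \<in> carrier D" "b \<in> carrier D"
      "q' \<in> carrier Dx" "a' \<in> carrier D" "b' \<in> carrier D"
    and p: "p = q \<otimes>\<^bsub>Dx\<^esub> G \<oplus>\<^bsub>Dx\<^esub> (cx a \<oplus>\<^bsub>Dx\<^esub> cx b \<otimes>\<^bsub>Dx\<^esub> X)"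
    and p': "p' = q' \<otimes>\<^bsub>Dx\<^esub> G \<oplus>\<^bsub>Dx\<^esub> (cx a' \<oplus>\<^bsub>Dx\<^esub> cx b' \<otimes>\<^bsub>Dx\<^esub> X)"
    by blast
  have "p \<oplus>\<^bsub>Dx\<^esub> p' = (q \<oplus>\<^bsub>Dx\<^esub> q') \<otimes>\<^bsub>Dx\<^esub> G \<oplus>\<^bsub>Dx\<^esub>
      (cx (a \<oplus> a') \<oplus>\<^bsub>Dx\<^esub> cx (b \<oplus> b') \<otimes>\<^bsub>Dx\<^esub> X)"
    unfolding p p' using qab by (simp add: x.P.l_distr cx_add x.P.a_ac)
  then show ?case
    using qab
    by (intro exI[of _ "q \<oplus>\<^bsub>Dx\<^esub> q'"] exI[of _ "a \<oplus> a'"] exI[of _ "b \<oplus> b'"]) simp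
qed

text \<open>
  Simplicity of \<open>D[x] / D[x] G\<close> as a module over \<open>D[x,y]\<close>, with \<open>y\<close> acting as right
  multiplication by \<open>c\<close>. Elements of \<open>L\<close> outside \<open>D[x] G\<close> have a nonzero remainder \<open>a + b x\<close>. A
  nonzero constant is a unit; otherwise the remainder can be made monic, \<open>x + e\<close>. Its commutator
  with \<open>c\<close> is the constant \<open>e c - c e\<close>. The left multiple \<open>(x - e)(x + e)\<close> is
  \<open>x\<^sup>2 - e\<^sup>2\<close> and differs from \<open>G\<close> by the constant \<open>t\<^sup>2 - e\<^sup>2\<close>. Both constants lie in \<open>L\<close>, and
  they cannot both vanish.
\<close>

lemma stable_left_ideal_trivial:
  assumes L: "left_ideal L Dx" and G: "G \<in> L"
    and stable: "\<And>p. p \<in> L \<Longrightarrow> p \<otimes>\<^bsub>Dx\<^esub> cx c \<in> L"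
    and p: "p \<in> L" "p \<notin> x.P.principal_left_ideal G"
  shows "\<one>\<^bsub>Dx\<^esub> \<in> L"
proof -
  interpret L: left_ideal L Dx by fact
  have unit: "\<one>\<^bsub>Dx\<^esub> \<in> L" if a: "cx a \<in> L" "a \<in> carrier D" "a \<noteq> \<zero>" for a
  proof -
    obtain b where "b \<in> carrier D" "b \<otimes> a = \<one>"
      using left_inverse a by blast
    then show ?thesis
      using L.l_closed[OF a(1), of "cx b"] a(2) by (simp flip: cx_mult)
  qed
  have "p \<in> carrier Dx" using p(1) L.a_subset by blast
  then obtain q a b where qab: "q \<in> carrier Dx" "a \<in> carrier D" "b \<in> carrier D"
    and p_eq: "p = q \<otimes>\<^bsub>Dx\<^esub> G \<oplus>\<^bsub>Dx\<^esub> (cx a \<oplus>\<^bsub>Dx\<^esub> cx b \<otimes>\<^bsub>Dx\<^esub> X)"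
    using G_remainder by blast
  have "p \<ominus>\<^bsub>Dx\<^esub> q \<otimes>\<^bsub>Dx\<^esub> G \<in> L"
    using p(1) L.l_closed[OF G qab(1)] by (rule L.minus_closed)
  moreover have "p \<ominus>\<^bsub>Dx\<^esub> q \<otimes>\<^bsub>Dx\<^esub> G = cx a \<oplus>\<^bsub>Dx\<^esub> cx b \<otimes>\<^bsub>Dx\<^esub> X"
    unfolding p_eq using qab by (simp add: x.P.add_minus_cancel_left)
  ultimately have r: "cx a \<oplus>\<^bsub>Dx\<^esub> cx b \<otimes>\<^bsub>Dx\<^esub> X \<in> L" by simp
  show ?thesis
  proof (cases "b = \<zero>")
    case True
    have "a \<noteq> \<zero>"
    proof
      assume "a = \<zero>"
      then have "p = q \<otimes>\<^bsub>Dx\<^esub> G" using p_eq True qab by simp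
      then show False using p(2) qab unfolding x.P.principal_left_ideal_def by blast
    qed
    then show ?thesis using unit[of a] r True qab by simp
  next
    case False
    then obtain b' where b': "b' \<in> carrier D" "b' \<otimes> b = \<one>"
      using left_inverse qab by blast
    define e where "e = b' \<otimes> a"
    have e [simp]: "e \<in> carrier D" unfolding e_def using b' qab by simp
    have "cx b' \<otimes>\<^bsub>Dx\<^esub> (cx a \<oplus>\<^bsub>Dx\<^esub> cx b \<otimes>\<^bsub>Dx\<^esub> X) = cx e \<oplus>\<^bsub>Dx\<^esub> X"
      using b' qab by (simp add: x.P.r_distr e_def cx_mult flip: x.P.m_assoc) (simp flip: cx_mult)
    then have Xe: "X \<oplus>\<^bsub>Dx\<^esub> cx e \<in> L"
      using L.l_closed[OF r, of "cx b'"] b' by (simp add: x.P.a_comm)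
    show ?thesis
    proof (cases "e \<otimes> c = c \<otimes> e")
      case True
      have "(X \<ominus>\<^bsub>Dx\<^esub> cx e) \<otimes>\<^bsub>Dx\<^esub> (X \<oplus>\<^bsub>Dx\<^esub> cx e) \<ominus>\<^bsub>Dx\<^esub> G \<in> L"
        using Xe G L.l_closed L.minus_closed by simp
      moreover have "(X \<ominus>\<^bsub>Dx\<^esub> cx e) \<otimes>\<^bsub>Dx\<^esub> (X \<oplus>\<^bsub>Dx\<^esub> cx e) \<ominus>\<^bsub>Dx\<^esub> G = cx (t \<otimes> t \<ominus> e \<otimes> e)"
        unfolding G_def
        by (simp add: x.P.square_diff x.P.minus_cancel_left X_cx_commute cx_minus cx_mult)
      ultimately have "cx (t \<otimes> t \<ominus> e \<otimes> e) \<in> L" by simp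
      moreover have "t \<otimes> t \<ominus> e \<otimes> e \<noteq> \<zero>"
        using no_root[of e] True by (metis e t_closed m_closed minus_zero_imp_eq)
      ultimately show ?thesis using unit by simp
    next
      case False
      have "(X \<oplus>\<^bsub>Dx\<^esub> cx e) \<otimes>\<^bsub>Dx\<^esub> cx c \<ominus>\<^bsub>Dx\<^esub> cx c \<otimes>\<^bsub>Dx\<^esub> (X \<oplus>\<^bsub>Dx\<^esub> cx e) \<in> L"
        using Xe stable L.l_closed L.minus_closed by simp
      moreover have "(X \<oplus>\<^bsub>Dx\<^esub> cx e) \<otimes>\<^bsub>Dx\<^esub> cx c \<ominus>\<^bsub>Dx\<^esub> cx c \<otimes>\<^bsub>Dx\<^esub> (X \<oplus>\<^bsub>Dx\<^esub> cx e)
          = cx (e \<otimes> c \<ominus> c \<otimes> e)"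
        by (simp add: x.P.commutator_add_central X_cx_commute cx_minus cx_mult)
      ultimately have "cx (e \<otimes> c \<ominus> c \<otimes> e) \<in> L" by simp
      moreover have "e \<otimes> c \<ominus> c \<otimes> e \<noteq> \<zero>"
        using False by (metis e c_closed m_closed minus_zero_imp_eq)
      ultimately show ?thesis using unit by simp
    qed
  qed
qed

definition M where
  "M = gen_left_ideal Dxy
     {(var_x D \<oplus>\<^bsub>Dxy\<^esub> const_xy D t) \<otimes>\<^bsub>Dxy\<^esub> (var_x D \<ominus>\<^bsub>Dxy\<^esub> const_xy D t),
      var_y D \<ominus>\<^bsub>Dxy\<^esub> const_xy D c}"

lemma const_y_closed [simp]: "p \<in> carrier Dx \<Longrightarrow> const_y D p \<in> carrier Dxy"
  unfolding const_y_def by simp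

lemma const_y_mult: "\<lbrakk>p \<in> carrier Dx; q \<in> carrier Dx\<rbrakk> \<Longrightarrow>
    const_y D (p \<otimes>\<^bsub>Dx\<^esub> q) = const_y D p \<otimes>\<^bsub>Dxy\<^esub> const_y D q"
  unfolding const_y_def using xy.monom_mult[of p q 0 0] by simp

lemma const_y_add: "\<lbrakk>p \<in> carrier Dx; q \<in> carrier Dx\<rbrakk> \<Longrightarrow>
    const_y D (p \<oplus>\<^bsub>Dx\<^esub> q) = const_y D p \<oplus>\<^bsub>Dxy\<^esub> const_y D q"
  unfolding const_y_def by simp

lemma const_y_minus: "\<lbrakk>p \<in> carrier Dx; q \<in> carrier Dx\<rbrakk> \<Longrightarrow>
    const_y D (p \<ominus>\<^bsub>Dx\<^esub> q) = const_y D p \<ominus>\<^bsub>Dxy\<^esub> const_y D q"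
  unfolding const_y_def a_minus_def by simp

lemma const_y_zero [simp]: "const_y D \<zero>\<^bsub>Dx\<^esub> = \<zero>\<^bsub>Dxy\<^esub>"
  unfolding const_y_def by simp

lemma const_y_one [simp]: "const_y D \<one>\<^bsub>Dx\<^esub> = \<one>\<^bsub>Dxy\<^esub>"
  unfolding const_y_def by simp

lemma var_y_closed [simp]: "var_y D \<in> carrier Dxy"
  unfolding var_y_def by simp

lemma var_y_commute: "f \<in> carrier Dxy \<Longrightarrow> f \<otimes>\<^bsub>Dxy\<^esub> var_y D = var_y D \<otimes>\<^bsub>Dxy\<^esub> f"
  unfolding var_y_def by (rule xy.X_central)

lemma M_alt: "M = gen_left_ideal Dxy {const_y D G, var_y D \<ominus>\<^bsub>Dxy\<^esub> const_y D (cx c)}"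
proof -
  have "const_y D G = (var_x D \<oplus>\<^bsub>Dxy\<^esub> const_xy D t) \<otimes>\<^bsub>Dxy\<^esub> (var_x D \<ominus>\<^bsub>Dxy\<^esub> const_xy D t)"
    unfolding G_def G_factor[OF t_closed, symmetric]
    by (simp add: const_y_mult const_y_add const_y_minus var_x_def const_xy_def X_def cx_def)
  then show ?thesis
    unfolding M_def by (simp add: const_xy_def cx_def)
qed

lemma M_left_ideal: "left_ideal M Dxy"
  unfolding M_alt by (rule xy.P.gen_left_ideal_left_ideal) simp

lemma G_in_M: "const_y D G \<in> M" and y_minus_c_in_M: "var_y D \<ominus>\<^bsub>Dxy\<^esub> const_y D (cx c) \<in> M"
  unfolding M_alt using xy.P.gen_left_ideal_subset by blast+

lemma inter_x_left_ideal:
  assumes "left_ideal J Dxy"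
  shows "left_ideal (inter_x D J) Dx"
proof (rule left_idealI)
  interpret J: left_ideal J Dxy by fact
  show "\<zero>\<^bsub>Dx\<^esub> \<in> inter_x D J" by (simp add: inter_x_def J.zero_closed)
  show "p \<oplus>\<^bsub>Dx\<^esub> q \<in> inter_x D J" if "p \<in> inter_x D J" "q \<in> inter_x D J" for p q
    using that by (simp add: inter_x_def const_y_add J.a_closed)
  show "p \<otimes>\<^bsub>Dx\<^esub> q \<in> inter_x D J" if "q \<in> inter_x D J" "p \<in> carrier Dx" for p q
    using that by (simp add: inter_x_def const_y_mult J.l_closed)
qed (auto simp: inter_x_def x.P.ring_axioms)

text \<open>
  As \<open>y\<close> is central, \<open>p c\<close> is congruent to \<open>y p\<close> modulo the multiple \<open>p (y - c)\<close> of a generator.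
\<close>

lemma inter_x_stable:
  assumes J: "left_ideal J Dxy" and "M \<subseteq> J" and p: "p \<in> inter_x D J"
  shows "p \<otimes>\<^bsub>Dx\<^esub> cx c \<in> inter_x D J"
proof -
  interpret J: left_ideal J Dxy by fact
  have p_closed [simp]: "p \<in> carrier Dx" and pJ: "const_y D p \<in> J"
    using p unfolding inter_x_def by auto
  let ?g = "var_y D \<ominus>\<^bsub>Dxy\<^esub> const_y D (cx c)"
  have "var_y D \<otimes>\<^bsub>Dxy\<^esub> const_y D p \<ominus>\<^bsub>Dxy\<^esub> const_y D p \<otimes>\<^bsub>Dxy\<^esub> ?g \<in> J"
    using pJ y_minus_c_in_M \<open>M \<subseteq> J\<close> J.l_closed J.minus_closed
    by (meson const_y_closed p_closed subsetD var_y_closed)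
  moreover have "var_y D \<otimes>\<^bsub>Dxy\<^esub> const_y D p \<ominus>\<^bsub>Dxy\<^esub> const_y D p \<otimes>\<^bsub>Dxy\<^esub> ?g =
      const_y D (p \<otimes>\<^bsub>Dx\<^esub> cx c)"
    by (simp add: xy.P.central_mult_minus var_y_commute const_y_mult)
  ultimately show ?thesis unfolding inter_x_def by simp
qed

text \<open>
  Modulo \<open>M\<close> the variable \<open>y\<close> can be moved to the right of every coefficient and replaced by \<open>c\<close>.
\<close>

lemma congruent_to_const_y:
  assumes "f \<in> carrier Dxy"
  shows "\<exists>p\<in>carrier Dx. f \<ominus>\<^bsub>Dxy\<^esub> const_y D p \<in> M"
proof -
  interpret M: left_ideal M Dxy by (rule M_left_ideal)
  show ?thesis
    using assms
  proof (induction rule: xy.UP_induct_X)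
    case (const p)
    then show ?case
      by (intro bexI[of _ p]) (auto simp: const_y_def M.zero_closed xy.P.minus_eq xy.P.r_neg)
  next
    case (X_mult f)
    then obtain p where p [simp]: "p \<in> carrier Dx" and "f \<ominus>\<^bsub>Dxy\<^esub> const_y D p \<in> M"
      by blast
    then have "var_y D \<otimes>\<^bsub>Dxy\<^esub> (f \<ominus>\<^bsub>Dxy\<^esub> const_y D p) \<oplus>\<^bsub>Dxy\<^esub>
        const_y D p \<otimes>\<^bsub>Dxy\<^esub> (var_y D \<ominus>\<^bsub>Dxy\<^esub> const_y D (cx c)) \<in> M"
      using y_minus_c_in_M by (intro M.a_closed M.l_closed) auto
    moreover have "var_y D \<otimes>\<^bsub>Dxy\<^esub> (f \<ominus>\<^bsub>Dxy\<^esub> const_y D p) \<oplus>\<^bsub>Dxy\<^esub>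
        const_y D p \<otimes>\<^bsub>Dxy\<^esub> (var_y D \<ominus>\<^bsub>Dxy\<^esub> const_y D (cx c)) =
        var_y D \<otimes>\<^bsub>Dxy\<^esub> f \<ominus>\<^bsub>Dxy\<^esub> const_y D (p \<otimes>\<^bsub>Dx\<^esub> cx c)"
      using X_mult(1)
      by (simp add: xy.P.central_mult_add var_y_commute const_y_mult)
    ultimately show ?case
      unfolding var_y_def[symmetric] by (intro bexI[of _ "p \<otimes>\<^bsub>Dx\<^esub> cx c"]) auto
  next
    case (add f g)
    then obtain p q where pq: "p \<in> carrier Dx" "q \<in> carrier Dx"
      and "f \<ominus>\<^bsub>Dxy\<^esub> const_y D p \<in> M" "g \<ominus>\<^bsub>Dxy\<^esub> const_y D q \<in> M"
      by blast
    then have "(f \<ominus>\<^bsub>Dxy\<^esub> const_y D p) \<oplus>\<^bsub>Dxy\<^esub> (g \<ominus>\<^bsub>Dxy\<^esub> const_y D q) \<in> M"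
      by (intro M.a_closed)
    moreover have "(f \<ominus>\<^bsub>Dxy\<^esub> const_y D p) \<oplus>\<^bsub>Dxy\<^esub> (g \<ominus>\<^bsub>Dxy\<^esub> const_y D q) =
        (f \<oplus>\<^bsub>Dxy\<^esub> g) \<ominus>\<^bsub>Dxy\<^esub> const_y D (p \<oplus>\<^bsub>Dx\<^esub> q)"
      using add(1,2) pq by (simp add: xy.P.add_diff_interchange const_y_add)
    ultimately show ?case using pq by auto
  qed
qed

text \<open>
  An upper bound for \<open>M\<close>: the polynomials whose right value at \<open>y = c\<close> lies in \<open>D[x] G\<close> form a left
  ideal that contains both generators. It shows that \<open>M\<close> adds nothing to \<open>D[x] G\<close> inside \<open>D[x]\<close>.
\<close>

lemma M_reval:
  assumes "f \<in> M"
  shows "xy.reval (cx c) f \<in> x.P.principal_left_ideal G"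
proof -
  let ?N = "x.P.principal_left_ideal G"
  let ?M' = "{f \<in> carrier Dxy. xy.reval (cx c) f \<in> ?N}"
  have N: "left_ideal ?N Dx"
    by (rule x.P.principal_left_ideal_left_ideal) simp
  interpret N: left_ideal ?N Dx by (rule N)
  have stable: "p \<otimes>\<^bsub>Dx\<^esub> cx c \<in> ?N" if p: "p \<in> ?N" for p
  proof -
    obtain q where q: "q \<in> carrier Dx" "p = q \<otimes>\<^bsub>Dx\<^esub> G"
      using p unfolding x.P.principal_left_ideal_def by blast
    then have "p \<otimes>\<^bsub>Dx\<^esub> cx c = (q \<otimes>\<^bsub>Dx\<^esub> cx c) \<otimes>\<^bsub>Dx\<^esub> G"
      by (simp add: x.P.m_assoc G_c_commute)
    then show ?thesis
      using q(1) unfolding x.P.principal_left_ideal_def by simp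
  qed
  have M': "left_ideal ?M' Dxy"
    using N stable by (intro xy.reval_vimage_left_ideal) auto
  have "xy.reval (cx c) (const_y D G) = G"
    unfolding const_y_def by (simp add: xy.reval_monom)
  moreover have "xy.reval (cx c) (var_y D \<ominus>\<^bsub>Dxy\<^esub> const_y D (cx c)) = \<zero>\<^bsub>Dx\<^esub>"
  proof -
    have "var_y D \<ominus>\<^bsub>Dxy\<^esub> const_y D (cx c) =
        monom Dxy \<one>\<^bsub>Dx\<^esub> 1 \<oplus>\<^bsub>Dxy\<^esub> monom Dxy (\<ominus>\<^bsub>Dx\<^esub> cx c) 0"
      unfolding var_y_def const_y_def by (simp add: xy.P.minus_eq)
    then show ?thesis
      by (simp add: xy.reval_add xy.reval_monom x.P.r_neg del: xy.monom_a_inv)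
  qed
  ultimately have "{const_y D G, var_y D \<ominus>\<^bsub>Dxy\<^esub> const_y D (cx c)} \<subseteq> ?M'"
    using x.P.principal_left_ideal_self[OF G_closed] N.zero_closed by simp
  then have "M \<subseteq> ?M'"
    unfolding M_alt by (rule xy.P.gen_left_ideal_minimal[OF M'])
  then show ?thesis using assms by blast
qed

lemma inter_x_M_principal: "inter_x D M \<subseteq> x.P.principal_left_ideal G"
proof
  fix p assume "p \<in> inter_x D M"
  then have "p \<in> carrier Dx" "xy.reval (cx c) (const_y D p) \<in> x.P.principal_left_ideal G"
    unfolding inter_x_def using M_reval by auto
  then show "p \<in> x.P.principal_left_ideal G"
    unfolding const_y_def by (simp add: xy.reval_monom)
qed

lemma principal_left_ideal_G: "p \<in> x.P.principal_left_ideal G \<Longrightarrow> p \<noteq> \<zero>\<^bsub>Dx\<^esub> \<Longrightarrow> 2 \<le> deg D p"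
  using x.principal_monic_deg_le[of G p] by (simp add: deg_G coeff_G)

text \<open>
  A left ideal \<open>J\<close> that properly contains \<open>M\<close> contains some \<open>p\<close> in \<open>D[x]\<close> outside \<open>D[x] G\<close>: reduce an
  element of \<open>J\<close> outside \<open>M\<close> modulo \<open>M\<close>. So \<open>D[x] \<inter> J\<close> is one of the left ideals covered by the
  simplicity statement, and contains 1.
\<close>

lemma M_maximal: "maximal_left_ideal M Dxy"
proof -
  interpret M: left_ideal M Dxy by (rule M_left_ideal)
  have "\<one>\<^bsub>Dxy\<^esub> \<notin> M"
  proof
    assume "\<one>\<^bsub>Dxy\<^esub> \<in> M"
    then have "\<one>\<^bsub>Dx\<^esub> \<in> inter_x D M" unfolding inter_x_def by simp
    then show False
      using inter_x_M_principal principal_left_ideal_G one_neq_zero_Dx x.deg_one by fastforce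
  qed
  moreover have "J = M \<or> J = carrier Dxy"
    if J: "left_ideal J Dxy" and "M \<subseteq> J" for J
  proof (cases "J = M")
    case False
    interpret J: left_ideal J Dxy by fact
    obtain f where f: "f \<in> J" "f \<notin> M"
      using False \<open>M \<subseteq> J\<close> by blast
    then have f_closed [simp]: "f \<in> carrier Dxy"
      using J.a_subset by blast
    then obtain p where p [simp]: "p \<in> carrier Dx" and fp: "f \<ominus>\<^bsub>Dxy\<^esub> const_y D p \<in> M"
      using congruent_to_const_y by blast
    have diff: "f \<ominus>\<^bsub>Dxy\<^esub> (f \<ominus>\<^bsub>Dxy\<^esub> const_y D p) = const_y D p"
      by (simp add: xy.P.minus_minus_cancel)
    have "const_y D p \<in> J"
      using J.minus_closed[of f "f \<ominus>\<^bsub>Dxy\<^esub> const_y D p"] f fp \<open>M \<subseteq> J\<close> diff by auto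
    then have "p \<in> inter_x D J"
      unfolding inter_x_def by simp
    moreover have "p \<notin> x.P.principal_left_ideal G"
    proof
      assume "p \<in> x.P.principal_left_ideal G"
      then obtain q where "q \<in> carrier Dx" "p = q \<otimes>\<^bsub>Dx\<^esub> G"
        unfolding x.P.principal_left_ideal_def by blast
      then have "const_y D p \<in> M"
        using M.l_closed[OF G_in_M] by (simp add: const_y_mult)
      then have "(f \<ominus>\<^bsub>Dxy\<^esub> const_y D p) \<oplus>\<^bsub>Dxy\<^esub> const_y D p \<in> M"
        using fp by (intro M.a_closed)
      then show False
        using f by (simp add: xy.P.minus_eq xy.P.a_assoc xy.P.l_neg)
    qed
    ultimately have "\<one>\<^bsub>Dx\<^esub> \<in> inter_x D J"
      using inter_x_left_ideal[OF J] inter_x_stable[OF J \<open>M \<subseteq> J\<close>] G_in_M \<open>M \<subseteq> J\<close>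
      by (intro stable_left_ideal_trivial[of _ p]) (auto simp: inter_x_def)
    then show ?thesis
      using J.eq_carrierI unfolding inter_x_def by simp
  qed simp
  ultimately show ?thesis
    unfolding maximal_left_ideal_def maximal_left_ideal_axioms_def
    using M_left_ideal by auto
qed

text \<open>
  The left ideal generated by \<open>x - t\<close> lies strictly between \<open>D[x] G\<close> and \<open>D[x]\<close>, by degrees.
\<close>

lemma inter_x_M_not_maximal: "\<not> maximal_left_ideal (inter_x D M) Dx"
proof
  assume "maximal_left_ideal (inter_x D M) Dx"
  then interpret N: maximal_left_ideal "inter_x D M" Dx .
  let ?h = "X \<ominus>\<^bsub>Dx\<^esub> cx t"
  let ?J = "x.P.principal_left_ideal ?h"
  have J: "left_ideal ?J Dx"
    by (rule x.P.principal_left_ideal_left_ideal) simp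
  interpret J: left_ideal ?J Dx by (rule J)
  have h: "?h \<in> ?J" by (rule x.P.principal_left_ideal_self) simp
  have "G \<in> ?J"
    using J.l_closed[OF h, of "X \<oplus>\<^bsub>Dx\<^esub> cx t"] G_factor[OF t_closed] by (simp add: G_def)
  then have "inter_x D M \<subseteq> ?J"
    using inter_x_M_principal J.l_closed unfolding x.P.principal_left_ideal_def[of G] by blast
  then consider "?J = inter_x D M" | "?J = carrier Dx"
    using N.I_maximal[OF J] J.a_subset by blast
  then show False
  proof cases
    case 1
    then have "?h \<in> x.P.principal_left_ideal G"
      using h inter_x_M_principal by blast
    moreover have "?h \<noteq> \<zero>\<^bsub>Dx\<^esub>" using deg_X_minus_t x.deg_zero by fastforce
    ultimately show False
      using principal_left_ideal_G deg_X_minus_t by fastforce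
  next
    case 2
    then have "\<one>\<^bsub>Dx\<^esub> \<in> ?J" by simp
    then show False
      using x.principal_monic_deg_le[of ?h "\<one>\<^bsub>Dx\<^esub>"] one_neq_zero_Dx
      by (simp add: deg_X_minus_t coeff_X_minus_t)
  qed
qed

end

section \<open>The division ring of skew Laurent series\<close>

lemma (in abelian_monoid) finsum_swap:
  assumes "finite A" and "finite B" and "\<And>i j. \<lbrakk>i \<in> A; j \<in> B\<rbrakk> \<Longrightarrow> f i j \<in> carrier G"
  shows "(\<Oplus>i\<in>A. \<Oplus>j\<in>B. f i j) = (\<Oplus>j\<in>B. \<Oplus>i\<in>A. f i j)"
  using assms(1,3)
proof (induction A rule: finite_induct)
  case (insert i A)
  then have "(\<Oplus>j\<in>B. \<Oplus>i\<in>insert i A. f i j) = (\<Oplus>j\<in>B. f i j \<oplus> (\<Oplus>i\<in>A. f i j))"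
    by (intro finsum_cong') (auto intro!: a_closed finsum_closed)
  also have "\<dots> = (\<Oplus>j\<in>B. f i j) \<oplus> (\<Oplus>j\<in>B. \<Oplus>i\<in>A. f i j)"
    using insert.prems by (intro finsum_addf) (auto intro!: finsum_closed)
  also have "\<dots> = (\<Oplus>i\<in>insert i A. \<Oplus>j\<in>B. f i j)"
    using insert by (subst finsum_insert) (auto intro!: finsum_closed)
  finally show ?case by simp
qed simp

locale skew_laurent_field = field K for K :: "('a, 'm) ring_scheme" (structure) +
  fixes \<sigma> :: "'a \<Rightarrow> 'a"
  assumes automorphism: "\<sigma> \<in> ring_iso K K"
begin

abbreviation D where "D \<equiv> skew_laurent K \<sigma>"
abbreviation pow_aut where "pow_aut \<equiv> aut_pow K \<sigma>"

lemma sigma_hom: "\<sigma> \<in> ring_hom K K"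
  using automorphism unfolding ring_iso_def by simp

lemma sigma_bij: "bij_betw \<sigma> (carrier K) (carrier K)"
  using automorphism unfolding ring_iso_def by simp

lemma sigma_closed [simp]: "a \<in> carrier K \<Longrightarrow> \<sigma> a \<in> carrier K"
  using sigma_bij bij_betwE by blast

lemma sigma_eq_iff: "\<lbrakk>a \<in> carrier K; b \<in> carrier K\<rbrakk> \<Longrightarrow> \<sigma> a = \<sigma> b \<longleftrightarrow> a = b"
  using sigma_bij unfolding bij_betw_def by (meson inj_on_eq_iff)

lemma inv_into_sigma_closed: "a \<in> carrier K \<Longrightarrow> inv_into (carrier K) \<sigma> a \<in> carrier K"
  using sigma_bij unfolding bij_betw_def by (metis inv_into_into)

lemma sigma_inv_into: "a \<in> carrier K \<Longrightarrow> \<sigma> (inv_into (carrier K) \<sigma> a) = a"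
  using sigma_bij by (meson bij_betw_inv_into_right)

lemma pow_aut_closed [simp]:
  assumes "a \<in> carrier K"
  shows "pow_aut i a \<in> carrier K"
proof -
  have "(\<sigma> ^^ n) a \<in> carrier K" "(inv_into (carrier K) \<sigma> ^^ n) a \<in> carrier K" for n
    using assms inv_into_sigma_closed by (induction n) auto
  then show ?thesis unfolding aut_pow_def by simp
qed

lemma pow_aut_0 [simp]: "pow_aut 0 a = a"
  unfolding aut_pow_def by simp

lemma sigma_pow_aut:
  assumes a: "a \<in> carrier K"
  shows "\<sigma> (pow_aut i a) = pow_aut (i + 1) a"
proof (cases "0 \<le> i")
  case True
  then show ?thesis unfolding aut_pow_def by (simp add: nat_add_distrib)
next
  case False
  define n where "n = nat (- i - 1)"
  have i: "i = - int (Suc n)" using False unfolding n_def by simp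
  have closed: "(inv_into (carrier K) \<sigma> ^^ n) a \<in> carrier K"
    using a inv_into_sigma_closed by (induction n) auto
  have "\<sigma> (pow_aut i a) = (inv_into (carrier K) \<sigma> ^^ n) a"
    unfolding aut_pow_def i using sigma_inv_into[OF closed] by (simp add: nat_add_distrib)
  also have "\<dots> = pow_aut (i + 1) a"
    unfolding aut_pow_def i by (cases n) (auto simp: nat_add_distrib)
  finally show ?thesis .
qed

lemma pow_aut_add:
  assumes a: "a \<in> carrier K"
  shows "pow_aut i (pow_aut j a) = pow_aut (i + j) a"
proof (induction i rule: int_induct[where k = 0])
  case (step1 i)
  then show ?case
    using sigma_pow_aut[of "pow_aut j a" i] sigma_pow_aut[of a "i + j"] a
    by (simp add: algebra_simps)
next
  case (step2 i)
  have "\<sigma> (pow_aut (i - 1) (pow_aut j a)) = \<sigma> (pow_aut (i - 1 + j) a)"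
    using step2 sigma_pow_aut[of "pow_aut j a" "i - 1"] sigma_pow_aut[of a "i - 1 + j"] a
    by (simp add: algebra_simps)
  then show ?case using a by (simp add: sigma_eq_iff)
qed simp

text \<open>
  A law for \<open>\<sigma>\<^sup>i\<close> that can be transported along \<open>\<sigma>\<close> in both directions (\<open>\<sigma>\<close> is injective, so it can
  also be cancelled) spreads from \<open>i = 0\<close> to all integers.
\<close>

lemma pow_aut_induct:
  assumes base: "Q (0 :: int)" and step: "\<And>i. Q i \<longleftrightarrow> Q (i + 1)"
  shows "Q i"
proof (induction i rule: int_induct[where k = 0])
  case (step2 i)
  then show ?case using step[of "i - 1"] by simp
qed (use base step in auto)

lemma pow_aut_ring_hom: "pow_aut i \<in> ring_hom K K"
proof (induction i rule: pow_aut_induct)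
  case (2 i)
  have sigma: "pow_aut (i + 1) a = \<sigma> (pow_aut i a)" if "a \<in> carrier K" for a
    using sigma_pow_aut that by simp
  have "pow_aut (i + 1) (a \<oplus> b) = pow_aut (i + 1) a \<oplus> pow_aut (i + 1) b
      \<longleftrightarrow> pow_aut i (a \<oplus> b) = pow_aut i a \<oplus> pow_aut i b"
    if "a \<in> carrier K" "b \<in> carrier K" for a b
    using that by (simp add: sigma sigma_eq_iff flip: ring_hom_add[OF sigma_hom])
  moreover have "pow_aut (i + 1) (a \<otimes> b) = pow_aut (i + 1) a \<otimes> pow_aut (i + 1) b
      \<longleftrightarrow> pow_aut i (a \<otimes> b) = pow_aut i a \<otimes> pow_aut i b"
    if "a \<in> carrier K" "b \<in> carrier K" for a b
    using that by (simp add: sigma sigma_eq_iff flip: ring_hom_mult[OF sigma_hom])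
  moreover have "pow_aut (i + 1) \<one> = \<one> \<longleftrightarrow> pow_aut i \<one> = \<one>"
    using sigma[of \<one>] sigma_eq_iff[of "pow_aut i \<one>" \<one>] ring_hom_one[OF sigma_hom] by simp
  ultimately show ?case
    unfolding ring_hom_def by auto
qed (auto simp: ring_hom_def)

lemma pow_aut_hom [simp]:
  shows "\<lbrakk>a \<in> carrier K; b \<in> carrier K\<rbrakk> \<Longrightarrow> pow_aut i (a \<oplus> b) = pow_aut i a \<oplus> pow_aut i b"
    and "\<lbrakk>a \<in> carrier K; b \<in> carrier K\<rbrakk> \<Longrightarrow> pow_aut i (a \<otimes> b) = pow_aut i a \<otimes> pow_aut i b"
    and "pow_aut i \<one> = \<one>"
    and "pow_aut i \<zero> = \<zero>"
  using ring_hom_add[OF pow_aut_ring_hom] ring_hom_mult[OF pow_aut_ring_hom]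
    ring_hom_one[OF pow_aut_ring_hom] ring_hom_zero[OF pow_aut_ring_hom ring_axioms ring_axioms]
  by blast+

lemma pow_aut_finsum:
  assumes "finite A" and "f \<in> A \<rightarrow> carrier K"
  shows "pow_aut i (\<Oplus>j\<in>A. f j) = (\<Oplus>j\<in>A. pow_aut i (f j))"
  using assms
proof (induction A rule: finite_induct)
  case (insert j A)
  then have "f \<in> A \<rightarrow> carrier K" "f j \<in> carrier K" by auto
  moreover from this have "(\<lambda>j. pow_aut i (f j)) \<in> A \<rightarrow> carrier K" by (simp add: Pi_iff)
  ultimately show ?case using insert by simp
qed simp

lemma pow_aut_eq_zero_iff:
  assumes "a \<in> carrier K"
  shows "pow_aut i a = \<zero> \<longleftrightarrow> a = \<zero>"
  using pow_aut_add[OF assms, of "- i" i] by auto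

lemma carrier_D: "f \<in> carrier D \<longleftrightarrow> (\<forall>i. f i \<in> carrier K) \<and> (\<exists>m. \<forall>i<m. f i = \<zero>)"
  unfolding skew_laurent_def by (auto simp: Pi_def)

lemma coeff_closed [simp]: "f \<in> carrier D \<Longrightarrow> f i \<in> carrier K"
  by (simp add: carrier_D)

lemma lower_bound: "f \<in> carrier D \<Longrightarrow> \<exists>m. \<forall>i<m. f i = \<zero>"
  by (simp add: carrier_D)

lemma add_D: "(f \<oplus>\<^bsub>D\<^esub> g) n = f n \<oplus> g n"
  unfolding skew_laurent_def by simp

lemma zero_D: "\<zero>\<^bsub>D\<^esub> n = \<zero>"
  unfolding skew_laurent_def by simp

lemma one_D: "\<one>\<^bsub>D\<^esub> n = (if n = 0 then \<one> else \<zero>)"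
  unfolding skew_laurent_def by simp

text \<open>
  The index set in the definition of the product depends on the supports of both factors, which
  makes products hard to compare. For factors that vanish below \<open>a\<close> and \<open>b\<close> every finite set
  that contains \<open>{a..n - b}\<close> may replace it, so that several products can be expanded over a
  common window.
\<close>

lemma mult_D_window:
  assumes f: "\<And>i. f i \<in> carrier K" and g: "\<And>i. g i \<in> carrier K"
    and "\<And>i. i < a \<Longrightarrow> f i = \<zero>" and "\<And>i. i < b \<Longrightarrow> g i = \<zero>"
    and W: "finite W" "{a..n - b} \<subseteq> W"
  shows "(f \<otimes>\<^bsub>D\<^esub> g) n = (\<Oplus>i\<in>W. f i \<otimes> pow_aut i (g (n - i)))"
proof -
  have "{i. f i \<noteq> \<zero> \<and> g (n - i) \<noteq> \<zero>} \<subseteq> {a..n - b}"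
  proof
    fix i assume "i \<in> {i. f i \<noteq> \<zero> \<and> g (n - i) \<noteq> \<zero>}"
    then have "\<not> i < a" "\<not> n - i < b" using assms(3,4) by auto
    then show "i \<in> {a..n - b}" by auto
  qed
  then show ?thesis
    unfolding skew_laurent_def using W f g
    by (auto intro!: add.finprod_mono_neutral_cong_left)
qed

lemma mult_D_closed:
  assumes f: "f \<in> carrier D" and g: "g \<in> carrier D"
  shows "f \<otimes>\<^bsub>D\<^esub> g \<in> carrier D"
proof -
  obtain a b where ab: "\<And>i. i < a \<Longrightarrow> f i = \<zero>" "\<And>i. i < b \<Longrightarrow> g i = \<zero>"
    using lower_bound f g by meson
  have eq: "(f \<otimes>\<^bsub>D\<^esub> g) n = (\<Oplus>i\<in>{a..n - b}. f i \<otimes> pow_aut i (g (n - i)))" for n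
    using f g ab by (intro mult_D_window) auto
  have "(f \<otimes>\<^bsub>D\<^esub> g) n = \<zero>" if "n < a + b" for n
    unfolding eq using that by simp
  moreover have "(f \<otimes>\<^bsub>D\<^esub> g) n \<in> carrier K" for n
    unfolding eq using f g by (intro finsum_closed) auto
  ultimately show ?thesis unfolding carrier_D by blast
qed

lemma mult_D_lowest:
  assumes f: "f \<in> carrier D" and g: "g \<in> carrier D"
    and "\<And>i. i < a \<Longrightarrow> f i = \<zero>" and "\<And>i. i < b \<Longrightarrow> g i = \<zero>"
  shows "(f \<otimes>\<^bsub>D\<^esub> g) (a + b) = f a \<otimes> pow_aut a (g b)"
  using assms mult_D_window[of f g a b "{a}" "a + b"] by simp

lemma monom_closed [simp]: "a \<in> carrier K \<Longrightarrow> sl_monom K a k \<in> carrier D"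
  unfolding carrier_D sl_monom_def by auto

lemma monom_mult_D:
  assumes "a \<in> carrier K" and f: "f \<in> carrier D"
  shows "(sl_monom K a k \<otimes>\<^bsub>D\<^esub> f) n = a \<otimes> pow_aut k (f (n - k))"
proof -
  obtain b where b: "\<And>i. i < b \<Longrightarrow> f i = \<zero>" using lower_bound[OF f] by blast
  have "(sl_monom K a k \<otimes>\<^bsub>D\<^esub> f) n =
      (\<Oplus>i\<in>insert k {k..n - b}. sl_monom K a k i \<otimes> pow_aut i (f (n - i)))"
    using assms b by (intro mult_D_window[where a = k and b = b]) (auto simp: sl_monom_def)
  also have "\<dots> = (\<Oplus>i\<in>{k}. a \<otimes> pow_aut i (f (n - i)))"
    using assms by (intro add.finprod_mono_neutral_cong_right) (auto simp: sl_monom_def)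
  finally show ?thesis using assms by simp
qed

lemma mult_monom_D:
  assumes "a \<in> carrier K" and f: "f \<in> carrier D"
  shows "(f \<otimes>\<^bsub>D\<^esub> sl_monom K a k) n = f (n - k) \<otimes> pow_aut (n - k) a"
proof -
  obtain b where b: "\<And>i. i < b \<Longrightarrow> f i = \<zero>" using lower_bound[OF f] by blast
  have "(f \<otimes>\<^bsub>D\<^esub> sl_monom K a k) n =
      (\<Oplus>i\<in>insert (n - k) {b..n - k}. f i \<otimes> pow_aut i (sl_monom K a k (n - i)))"
    using assms b by (intro mult_D_window[where a = b and b = k]) (auto simp: sl_monom_def)
  also have "\<dots> = (\<Oplus>i\<in>{n - k}. f i \<otimes> pow_aut i a)"
    using assms by (intro add.finprod_mono_neutral_cong_right) (auto simp: sl_monom_def)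
  finally show ?thesis using assms by simp
qed

lemma monom_mult_monom:
  assumes "a \<in> carrier K" and "b \<in> carrier K"
  shows "sl_monom K a i \<otimes>\<^bsub>D\<^esub> sl_monom K b j = sl_monom K (a \<otimes> pow_aut i b) (i + j)"
proof
  fix n
  show "(sl_monom K a i \<otimes>\<^bsub>D\<^esub> sl_monom K b j) n = sl_monom K (a \<otimes> pow_aut i b) (i + j) n"
    unfolding monom_mult_D[OF assms(1) monom_closed[OF assms(2)]]
    using assms by (auto simp: sl_monom_def)
qed

lemma one_D_monom: "\<one>\<^bsub>D\<^esub> = sl_monom K \<one> 0"
  unfolding skew_laurent_def sl_monom_def by simp

text \<open>
  Both sides at degree \<open>n\<close> are double sums of \<open>f\<^sub>j \<sigma>\<^sup>j(g\<^sub>k) \<sigma>\<^sup>j\<^sup>+\<^sup>k(h\<^sub>l)\<close> with \<open>j + k + l = n\<close>. Choosing the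
  windows for \<open>j\<close> and \<open>i = j + k\<close> from the lower bounds alone makes them independent of each other,
  and the sums can be exchanged.
\<close>

lemma mult_D_assoc:
  assumes f: "f \<in> carrier D" and g: "g \<in> carrier D" and h: "h \<in> carrier D"
  shows "(f \<otimes>\<^bsub>D\<^esub> g) \<otimes>\<^bsub>D\<^esub> h = f \<otimes>\<^bsub>D\<^esub> (g \<otimes>\<^bsub>D\<^esub> h)"
proof
  fix n
  obtain a b d where abd: "\<And>i. i < a \<Longrightarrow> f i = \<zero>" "\<And>i. i < b \<Longrightarrow> g i = \<zero>" "\<And>i. i < d \<Longrightarrow> h i = \<zero>"
    using lower_bound f g h by meson
  note [simp] = coeff_closed[OF f] coeff_closed[OF g] coeff_closed[OF h]
  let ?I = "{a + b..n - d}" and ?J = "{a..n - b - d}"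
  have fg_zero: "(f \<otimes>\<^bsub>D\<^esub> g) i = \<zero>" if "i < a + b" for i
    using mult_D_window[of f g a b "{}" i] abd that by simp
  have gh_zero: "(g \<otimes>\<^bsub>D\<^esub> h) i = \<zero>" if "i < b + d" for i
    using mult_D_window[of g h b d "{}" i] abd that by simp
  have "((f \<otimes>\<^bsub>D\<^esub> g) \<otimes>\<^bsub>D\<^esub> h) n = (\<Oplus>i\<in>?I. (f \<otimes>\<^bsub>D\<^esub> g) i \<otimes> pow_aut i (h (n - i)))"
    using mult_D_closed[OF f g] fg_zero abd
    by (intro mult_D_window) auto
  also have "\<dots> = (\<Oplus>i\<in>?I. \<Oplus>j\<in>?J. f j \<otimes> pow_aut j (g (i - j)) \<otimes> pow_aut i (h (n - i)))"
  proof (rule finsum_cong')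
    fix i assume "i \<in> ?I"
    then have "(f \<otimes>\<^bsub>D\<^esub> g) i = (\<Oplus>j\<in>?J. f j \<otimes> pow_aut j (g (i - j)))"
      using abd by (intro mult_D_window[where a = a and b = b]) auto
    then show "(f \<otimes>\<^bsub>D\<^esub> g) i \<otimes> pow_aut i (h (n - i)) =
        (\<Oplus>j\<in>?J. f j \<otimes> pow_aut j (g (i - j)) \<otimes> pow_aut i (h (n - i)))"
      by (simp add: finsum_ldistr Pi_def)
  qed (auto intro!: finsum_closed)
  also have "\<dots> = (\<Oplus>j\<in>?J. \<Oplus>i\<in>?I. f j \<otimes> pow_aut j (g (i - j)) \<otimes> pow_aut i (h (n - i)))"
    by (rule finsum_swap) auto
  also have "\<dots> = (\<Oplus>j\<in>?J. f j \<otimes> pow_aut j ((g \<otimes>\<^bsub>D\<^esub> h) (n - j)))"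
  proof (rule finsum_cong')
    fix j assume j: "j \<in> ?J"
    let ?L = "{a + b - j..n - d - j}"
    have "(g \<otimes>\<^bsub>D\<^esub> h) (n - j) = (\<Oplus>k\<in>?L. g k \<otimes> pow_aut k (h (n - j - k)))"
      using abd j by (intro mult_D_window[where a = b and b = d]) auto
    then have "f j \<otimes> pow_aut j ((g \<otimes>\<^bsub>D\<^esub> h) (n - j)) =
        (\<Oplus>k\<in>?L. f j \<otimes> pow_aut j (g k) \<otimes> pow_aut (j + k) (h (n - j - k)))"
      by (simp add: pow_aut_finsum finsum_rdistr Pi_def pow_aut_add m_assoc)
    also have "\<dots> = (\<Oplus>i\<in>(+) j ` ?L. f j \<otimes> pow_aut j (g (i - j)) \<otimes> pow_aut i (h (n - i)))"
      by (subst finsum_reindex) (auto simp: algebra_simps)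
    also have "(+) j ` ?L = ?I" by simp
    finally show "(\<Oplus>i\<in>?I. f j \<otimes> pow_aut j (g (i - j)) \<otimes> pow_aut i (h (n - i))) =
        f j \<otimes> pow_aut j ((g \<otimes>\<^bsub>D\<^esub> h) (n - j))" ..
  qed (use mult_D_closed[OF g h] in auto)
  also have "\<dots> = (f \<otimes>\<^bsub>D\<^esub> (g \<otimes>\<^bsub>D\<^esub> h)) n"
    using mult_D_closed[OF g h] gh_zero abd
    by (intro mult_D_window[symmetric, where a = a and b = "b + d"]) auto
  finally show "((f \<otimes>\<^bsub>D\<^esub> g) \<otimes>\<^bsub>D\<^esub> h) n = (f \<otimes>\<^bsub>D\<^esub> (g \<otimes>\<^bsub>D\<^esub> h)) n" .
qed

lemma add_D_closed:
  assumes f: "f \<in> carrier D" and g: "g \<in> carrier D"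
  shows "f \<oplus>\<^bsub>D\<^esub> g \<in> carrier D"
proof -
  obtain a b where "\<And>i. i < a \<Longrightarrow> f i = \<zero>" "\<And>i. i < b \<Longrightarrow> g i = \<zero>"
    using lower_bound f g by meson
  then have "\<forall>i < min a b. (f \<oplus>\<^bsub>D\<^esub> g) i = \<zero>" by (simp add: add_D)
  then have "\<exists>m. \<forall>i<m. (f \<oplus>\<^bsub>D\<^esub> g) i = \<zero>" ..
  then show ?thesis using f g by (simp add: carrier_D add_D)
qed

lemma mult_D_distr:
  assumes f: "f \<in> carrier D" and g: "g \<in> carrier D" and h: "h \<in> carrier D"
  shows "(f \<oplus>\<^bsub>D\<^esub> g) \<otimes>\<^bsub>D\<^esub> h = f \<otimes>\<^bsub>D\<^esub> h \<oplus>\<^bsub>D\<^esub> g \<otimes>\<^bsub>D\<^esub> h"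
    and "h \<otimes>\<^bsub>D\<^esub> (f \<oplus>\<^bsub>D\<^esub> g) = h \<otimes>\<^bsub>D\<^esub> f \<oplus>\<^bsub>D\<^esub> h \<otimes>\<^bsub>D\<^esub> g"
proof -
  obtain a b d where abd: "\<And>i. i < a \<Longrightarrow> f i = \<zero>" "\<And>i. i < b \<Longrightarrow> g i = \<zero>" "\<And>i. i < d \<Longrightarrow> h i = \<zero>"
    using lower_bound f g h by meson
  note [simp] = coeff_closed[OF f] coeff_closed[OF g] coeff_closed[OF h]
    coeff_closed[OF add_D_closed[OF f g]]
  define m where "m = min a b"
  have low: "p i = \<zero>" if "i < m" "p \<in> {f, g, f \<oplus>\<^bsub>D\<^esub> g}" for p i
    using that abd by (auto simp: add_D m_def)
  show "(f \<oplus>\<^bsub>D\<^esub> g) \<otimes>\<^bsub>D\<^esub> h = f \<otimes>\<^bsub>D\<^esub> h \<oplus>\<^bsub>D\<^esub> g \<otimes>\<^bsub>D\<^esub> h"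
  proof
    fix n
    have win: "(p \<otimes>\<^bsub>D\<^esub> h) n = (\<Oplus>i\<in>{m..n - d}. p i \<otimes> pow_aut i (h (n - i)))"
      if "p \<in> {f, g, f \<oplus>\<^bsub>D\<^esub> g}" for p
      using that low[OF _ that] abd by (intro mult_D_window) auto
    show "((f \<oplus>\<^bsub>D\<^esub> g) \<otimes>\<^bsub>D\<^esub> h) n = (f \<otimes>\<^bsub>D\<^esub> h \<oplus>\<^bsub>D\<^esub> g \<otimes>\<^bsub>D\<^esub> h) n"
      by (simp add: win add_D l_distr finsum_addf Pi_def)
  qed
  show "h \<otimes>\<^bsub>D\<^esub> (f \<oplus>\<^bsub>D\<^esub> g) = h \<otimes>\<^bsub>D\<^esub> f \<oplus>\<^bsub>D\<^esub> h \<otimes>\<^bsub>D\<^esub> g"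
  proof
    fix n
    have win: "(h \<otimes>\<^bsub>D\<^esub> p) n = (\<Oplus>i\<in>{d..n - m}. h i \<otimes> pow_aut i (p (n - i)))"
      if "p \<in> {f, g, f \<oplus>\<^bsub>D\<^esub> g}" for p
      using that low[OF _ that] abd by (intro mult_D_window) auto
    show "(h \<otimes>\<^bsub>D\<^esub> (f \<oplus>\<^bsub>D\<^esub> g)) n = (h \<otimes>\<^bsub>D\<^esub> f \<oplus>\<^bsub>D\<^esub> h \<otimes>\<^bsub>D\<^esub> g) n"
      by (simp add: win add_D r_distr finsum_addf Pi_def)
  qed
qed

lemma ring_D: "ring D"
proof (rule ringI)
  show "abelian_group D"
  proof (rule abelian_groupI)
    show "\<exists>g\<in>carrier D. g \<oplus>\<^bsub>D\<^esub> f = \<zero>\<^bsub>D\<^esub>" if "f \<in> carrier D" for f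
    proof
      show "(\<lambda>n. \<ominus> f n) \<in> carrier D"
        using that unfolding carrier_D by (metis a_inv_closed minus_zero)
      show "(\<lambda>n. \<ominus> f n) \<oplus>\<^bsub>D\<^esub> f = \<zero>\<^bsub>D\<^esub>"
        using that by (auto simp: add_D zero_D l_neg)
    qed
    show "\<zero>\<^bsub>D\<^esub> \<in> carrier D" by (simp add: carrier_D zero_D)
  qed (simp_all add: add_D_closed add_D zero_D a_ac fun_eq_iff)
  show "monoid D"
  proof (rule monoidI)
    show "\<one>\<^bsub>D\<^esub> \<in> carrier D" unfolding one_D_monom by simp
    show "\<one>\<^bsub>D\<^esub> \<otimes>\<^bsub>D\<^esub> f = f" if "f \<in> carrier D" for f
      unfolding one_D_monom using that by (auto simp: monom_mult_D)
    show "f \<otimes>\<^bsub>D\<^esub> \<one>\<^bsub>D\<^esub> = f" if "f \<in> carrier D" for f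
      unfolding one_D_monom using that by (auto simp: mult_monom_D)
  qed (simp_all add: mult_D_closed mult_D_assoc)
qed (simp_all add: mult_D_distr)

lemma lowest_term:
  assumes f: "f \<in> carrier D" and "f \<noteq> \<zero>\<^bsub>D\<^esub>"
  obtains m where "f m \<noteq> \<zero>" and "\<And>i. i < m \<Longrightarrow> f i = \<zero>"
proof -
  obtain a where a: "\<And>i. i < a \<Longrightarrow> f i = \<zero>" using lower_bound[OF f] by blast
  obtain k where k: "f k \<noteq> \<zero>" using \<open>f \<noteq> \<zero>\<^bsub>D\<^esub>\<close> unfolding fun_eq_iff zero_D by blast
  then have "a \<le> k" using a by force
  define l where "l = (LEAST l. f (a + int l) \<noteq> \<zero>)"
  have "f (a + int (nat (k - a))) \<noteq> \<zero>" using k \<open>a \<le> k\<close> by simp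
  then have l: "f (a + int l) \<noteq> \<zero>" unfolding l_def by (rule LeastI)
  have "f i = \<zero>" if "i < a + int l" for i
  proof (cases "i < a")
    case False
    then have "nat (i - a) < l" using that by linarith
    then have "f (a + int (nat (i - a))) = \<zero>"
      unfolding l_def using not_less_Least by blast
    then show ?thesis using False by simp
  qed (rule a)
  then show ?thesis using l that by blast
qed

text \<open>
  If \<open>f\<close> has lowest degree \<open>m\<close>, a left inverse \<open>g\<close> starts in degree \<open>- m\<close>. Comparing coefficients
  in degree \<open>k \<ge> 0\<close> gives an equation for \<open>g\<^bsub>k - m\<^esub>\<close> in terms of earlier coefficients of \<open>g\<close>, in which
  \<open>g\<^bsub>k - m\<^esub>\<close> is multiplied by the nonzero element \<open>\<sigma>\<^bsup>k - m\<^esup>(f\<^sub>m)\<close>; so \<open>g\<close> is found by recursion.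
\<close>

lemma division_ring_left_inverse:
  assumes f: "f \<in> carrier D" and "f \<noteq> \<zero>\<^bsub>D\<^esub>"
  shows "\<exists>g\<in>carrier D. g \<otimes>\<^bsub>D\<^esub> f = \<one>\<^bsub>D\<^esub>"
proof -
  obtain m where m: "f m \<noteq> \<zero>" and low: "\<And>i. i < m \<Longrightarrow> f i = \<zero>"
    using lowest_term[OF assms] by blast
  note [simp] = coeff_closed[OF f]
  let ?u = "\<lambda>k. pow_aut (int k - m) (f m)"
  have u: "?u k \<in> carrier K" "inv (?u k) \<in> carrier K" "inv (?u k) \<otimes> ?u k = \<one>" for k
  proof -
    have "?u k \<in> Units K" using m by (simp add: field_Units pow_aut_eq_zero_iff)
    then show "?u k \<in> carrier K" "inv (?u k) \<in> carrier K" "inv (?u k) \<otimes> ?u k = \<one>"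
      by auto
  qed
  define step where "step h k =
      ((if k = 0 then \<one> else \<zero>) \<ominus>
        (\<Oplus>j\<in>{..<k}. h j \<otimes> pow_aut (int j - m) (f (m + int k - int j)))) \<otimes> inv (?u k)"
    for h :: "nat \<Rightarrow> 'a" and k
  \<comment> \<open>Finite sums can be compared termwise only if the summands lie in the carrier; the guard makes
    this available in the proof that \<open>F h k\<close> depends on \<open>h\<close> below \<open>k\<close> only.\<close>
  define F where "F h k = (if \<forall>j<k. h j \<in> carrier K then step h k else \<zero>)" for h k
  have "adm_wf less_than F"
    unfolding adm_wf_def
  proof (intro allI impI)
    fix h h' :: "nat \<Rightarrow> 'a" and k
    assume eq: "\<forall>j. (j, k) \<in> less_than \<longrightarrow> h j = h' j"
    have "step h k = step h' k" if "\<forall>j<k. h j \<in> carrier K"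
    proof -
      have "(\<Oplus>j\<in>{..<k}. h j \<otimes> pow_aut (int j - m) (f (m + int k - int j))) =
          (\<Oplus>j\<in>{..<k}. h' j \<otimes> pow_aut (int j - m) (f (m + int k - int j)))"
        using eq that by (intro finsum_cong') auto
      then show ?thesis unfolding step_def by simp
    qed
    then show "F h k = F h' k" unfolding F_def using eq by auto
  qed
  then obtain h where h: "h = F h"
    using wfrec_fixpoint[OF wf_less_than] by metis
  have h_closed [simp]: "h k \<in> carrier K" for k
  proof (induction k rule: less_induct)
    case (less k)
    then have "h k = step h k" using fun_cong[OF h, of k] unfolding F_def by simp
    also have "\<dots> \<in> carrier K"
      unfolding step_def using less u by (intro m_closed minus_closed finsum_closed) auto
    finally show ?case .
  qed
  let ?s = "\<lambda>k. \<Oplus>j\<in>{..<k}. h j \<otimes> pow_aut (int j - m) (f (m + int k - int j))"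
  have s_closed: "?s k \<in> carrier K" for k
    by (intro finsum_closed) auto
  have h_u: "?s k \<oplus> h k \<otimes> ?u k = (if k = 0 then \<one> else \<zero>)" for k
  proof -
    have "h k = step h k" using fun_cong[OF h, of k] unfolding F_def by simp
    then have "h k \<otimes> ?u k = (if k = 0 then \<one> else \<zero>) \<ominus> ?s k"
      unfolding step_def using u s_closed by (simp add: m_assoc)
    then show ?thesis using s_closed[of k] by (simp add: minus_eq a_lcomm r_neg)
  qed
  define g where "g n = (if n < - m then \<zero> else h (nat (n + m)))" for n
  have g: "g \<in> carrier D" unfolding carrier_D g_def by auto
  have gf: "(g \<otimes>\<^bsub>D\<^esub> f) n = (\<Oplus>i\<in>{- m..n - m}. g i \<otimes> pow_aut i (f (n - i)))" for n
    using g low by (intro mult_D_window) (auto simp: g_def)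
  have "(g \<otimes>\<^bsub>D\<^esub> f) n = \<one>\<^bsub>D\<^esub> n" for n
  proof (cases "n < 0")
    case True
    then show ?thesis unfolding gf by (simp add: one_D)
  next
    case False
    define k where "k = nat n"
    have n: "n = int k" using False unfolding k_def by simp
    have window: "{- m..n - m} = (\<lambda>j. int j - m) ` {..k}"
    proof
      show "{- m..n - m} \<subseteq> (\<lambda>j. int j - m) ` {..k}"
      proof
        fix i assume "i \<in> {- m..n - m}"
        then show "i \<in> (\<lambda>j. int j - m) ` {..k}"
          unfolding n by (intro image_eqI[of _ _ "nat (i + m)"]) auto
      qed
    qed (auto simp: n)
    have "(g \<otimes>\<^bsub>D\<^esub> f) n = (\<Oplus>j\<in>{..k}. h j \<otimes> pow_aut (int j - m) (f (m + int k - int j)))"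
      unfolding gf window
      by (subst finsum_reindex) (auto simp: inj_on_def g_def n algebra_simps)
    also have "{..k} = insert k {..<k}" by auto
    also have "(\<Oplus>j\<in>insert k {..<k}. h j \<otimes> pow_aut (int j - m) (f (m + int k - int j))) =
        ?s k \<oplus> h k \<otimes> ?u k"
      using s_closed[of k] u(1)[of k] by (subst finsum_insert) (auto simp: a_comm)
    also have "\<dots> = \<one>\<^bsub>D\<^esub> n" unfolding h_u by (simp add: one_D n)
    finally show ?thesis .
  qed
  then show ?thesis using g by blast
qed

text \<open>
  If \<open>d\<^sup>2 = t\<^sup>2\<close>, comparing lowest degrees shows that \<open>d\<close> starts in degree 1, as \<open>K\<close> has no
  zero divisors. In that degree \<open>d c = c d\<close> reads \<open>d\<^sub>1 \<sigma>(c) = c d\<^sub>1\<close>, which forces \<open>\<sigma>(c) = c\<close>.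
\<close>

lemma commuting_square_neq:
  assumes c: "c \<in> carrier K" and "\<sigma> c \<noteq> c"
    and d: "d \<in> carrier D"
    and commute: "d \<otimes>\<^bsub>D\<^esub> sl_monom K c 0 = sl_monom K c 0 \<otimes>\<^bsub>D\<^esub> d"
  shows "d \<otimes>\<^bsub>D\<^esub> d \<noteq> sl_monom K \<one> 1 \<otimes>\<^bsub>D\<^esub> sl_monom K \<one> 1"
proof
  assume "d \<otimes>\<^bsub>D\<^esub> d = sl_monom K \<one> 1 \<otimes>\<^bsub>D\<^esub> sl_monom K \<one> 1"
  then have dd: "(d \<otimes>\<^bsub>D\<^esub> d) n = (if n = 2 then \<one> else \<zero>)" for n
    by (simp add: monom_mult_monom) (simp add: sl_monom_def)
  interpret D: ring D by (rule ring_D)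
  have "d \<noteq> \<zero>\<^bsub>D\<^esub>" using dd[of 2] by (auto simp: zero_D)
  then obtain m where m: "d m \<noteq> \<zero>" and low: "\<And>i. i < m \<Longrightarrow> d i = \<zero>"
    using lowest_term[OF d] by blast
  have "(d \<otimes>\<^bsub>D\<^esub> d) (m + m) = d m \<otimes> pow_aut m (d m)"
    using mult_D_lowest[OF d d low low] .
  moreover have "d m \<otimes> pow_aut m (d m) \<noteq> \<zero>"
    using m d by (simp add: integral_iff pow_aut_eq_zero_iff)
  ultimately have "m = 1" using dd[of "m + m"] by (auto split: if_splits)
  have "d m \<otimes> pow_aut m c = c \<otimes> d m"
    using fun_cong[OF commute, of m] c d by (simp add: monom_mult_D mult_monom_D)
  moreover have "pow_aut m c = \<sigma> c" unfolding \<open>m = 1\<close> aut_pow_def by simp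
  ultimately have "d m \<otimes> \<sigma> c = d m \<otimes> c" using m_comm[OF c, of "d m"] d by simp
  then show False
    using m_lcancel[of "d m" "\<sigma> c" c] m c d \<open>\<sigma> c \<noteq> c\<close> by simp
qed

end

section \<open>The left ideal over skew Laurent series\<close>

theorem proposition2p4:
  fixes K :: "('a, 'm) ring_scheme" (structure) and \<sigma> :: "'a \<Rightarrow> 'a" and c :: 'a
  assumes "field K"
    and "\<sigma> \<in> ring_iso K K"
    and "c \<in> carrier K"
    and "\<sigma> c \<noteq> c"
    and "\<sigma> (\<sigma> c) = c"
  shows "maximal_left_ideal (sl_left_ideal K \<sigma> c) (UP2 (skew_laurent K \<sigma>)) \<and>
         \<not> maximal_left_ideal (inter_x (skew_laurent K \<sigma>) (sl_left_ideal K \<sigma> c))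
             (UP (skew_laurent K \<sigma>))"
proof -
  interpret K: field K by fact
  interpret S: skew_laurent_field K \<sigma>
    by unfold_locales (rule assms(2))
  let ?D = "skew_laurent K \<sigma>"
  let ?t = "sl_monom K \<one> 1" and ?c = "sl_monom K c 0"
  have "S.pow_aut 2 c = c"
    using assms(5) by (simp add: aut_pow_def numeral_2_eq_2)
  then have commute: "?c \<otimes>\<^bsub>?D\<^esub> (?t \<otimes>\<^bsub>?D\<^esub> ?t) = ?t \<otimes>\<^bsub>?D\<^esub> ?t \<otimes>\<^bsub>?D\<^esub> ?c"
    using assms(3) by (simp add: S.monom_mult_monom)
  interpret no_commuting_root ?D ?t ?c
  proof (intro no_commuting_root.intro no_commuting_root_axioms.intro)
    show "ring ?D" by (rule S.ring_D)
    show "\<one>\<^bsub>?D\<^esub> \<noteq> \<zero>\<^bsub>?D\<^esub>"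
      using S.one_D[of 0] S.zero_D[of 0] by (metis K.one_not_zero)
  qed (use assms commute S.division_ring_left_inverse S.commuting_square_neq in auto)
  have "M = sl_left_ideal K \<sigma> c"
    unfolding M_def sl_left_ideal_def Let_def ..
  then show ?thesis
    using M_maximal inter_x_M_not_maximal by simp
qed

end
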